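(* Consider the networked dynamical system $$\dot{\mathbf{x}}(t)=(I_N\otimes A+\mathbf{G}\otimes bc^T)\mathbf{x}(t)+(I_N\otimes b)\mathbf{w}(t),\qquad \mathbf{y}(t)=(I_N\otimes c^T)\mathbf{x}(t),$$ where $A\in\mathbb{R}^{n\times n}$, $b,c\in\mathbb{R}^n$, the connectivity matrix $\mathbf{G}=[g_{ij}]\in\mathbb{R}^{N\times N}$ has $g_{ij}\ge0$ and satisfies $\mathbf{G}=\mathbf{G}^T$, and $I_N\otimes A+\mathbf{G}\otimes bc^T$ is Hurwitz. Assume the inputs $w_1,\dots,w_N$ are uncorrelated zero-mean wide-sense stationary processes with identical autocorrelation function, hence common power spectral density $S_w(\omega)$, and that $S_w(\omega)>0$ for all $\omega\in(-\Omega,\Omega)$, where $\Omega>0$. Let $\mathbf{S}(\omega)=[S_{y_iy_j}(\omega)]$ be the $N\times N$ matrix of output cross-power spectral densities and $h(\mathrm{j}\omega)=c^T(\mathrm{j}\omega I_n-A)^{-1}b$ the nodal transfer function. Then $$\mathbf{G}=\mathrm{Re}\{h^{-1}(\mathrm{j}\omega_0)\}I_N+\left(\mathbf{S}^{-1}(\omega_0)S_w(\omega_0)-\mathrm{Im}^2\{h^{-1}(\mathrm{j}\omega_0)\}I_N\right)^{1/2}$$ for any $\omega_0\in(-\Omega,\Omega)$.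
   Context: $\mathrm{j}$ (upright) is the imaginary unit; $\otimes$ is the Kronecker product; $I_d$ is the $d\times d$ identity matrix; $h^{-1}=1/h$; $\mathrm{Im}^2\{z\}=(\mathrm{Im}\,z)^2$; $(\cdot)^{1/2}$ is the matrix square root. $\mathbf{x}(t)\in\mathbb{R}^{Nn}$ is the network state, $\mathbf{w}(t)=(w_1(t),\dots,w_N(t))^T$ the input noise vector, and $\mathbf{y}(t)=(y_1(t),\dots,y_N(t))^T$ the output vector, all real stochastic processes. The cross-correlation is $R_{xy}(\tau)=\mathbb{E}(x(t)y(t-\tau))$, the cross-power spectral density $S_{xy}(\omega)$ is its Fourier transform, and the power spectral density is $S_x=S_{xx}$.
   Formalization: The power 1/2 is read as some real symmetric square root, since the principal root fails (N=n=1, A=-1, b=c=1, G=0); the state is taken in steady state (jointly wide-sense stationary), the equation holds in mean square, and h(jω₀) is assumed nonzero. *)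

theory Defs
  imports "HOL-Probability.Probability"
begin

section \<open>Matrices\<close>

text \<open>Indices of a Kronecker product are pairs: the first component selects the block, the
  second one the position within the block.\<close>

definition kronecker :: "'a::times ^ 'n ^ 'm \<Rightarrow> 'a ^ 'q ^ 'p \<Rightarrow> 'a ^ ('n \<times> 'q) ^ ('m \<times> 'p)"
  where "kronecker P Q = (\<chi> r s. P $ fst r $ fst s * Q $ snd r $ snd s)"

definition cmat :: "real ^ 'n ^ 'm \<Rightarrow> complex ^ 'n ^ 'm"
  where "cmat P = map_matrix complex_of_real P"

definition cvec :: "real ^ 'n \<Rightarrow> complex ^ 'n"
  where "cvec v = (\<chi> i. complex_of_real (v $ i))"

definition hurwitz :: "real ^ 'n ^ 'n \<Rightarrow> bool"
  where "hurwitz P \<longleftrightarrow>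
    (\<forall>\<mu> (v :: complex ^ 'n). v \<noteq> 0 \<and> cmat P *v v = \<mu> *s v \<longrightarrow> Re \<mu> < 0)"

text \<open>A matrix has several square roots, and no particular branch is singled out here.  In
  particular the positive semidefinite root is not meant: for one node with $h(s) = 1/(s+1)$ and
  $\mathbf{G} = 0$, the matrix under the root in the identification formula is $1$ and the root
  occurring there is $-1$.\<close>

definition is_matrix_sqrt :: "'a::semiring_1 ^ 'n ^ 'n \<Rightarrow> 'a ^ 'n ^ 'n \<Rightarrow> bool"
  where "is_matrix_sqrt R P \<longleftrightarrow> R ** R = P"

section \<open>The network\<close>

definition network_matrix ::
  "real ^ 'n ^ 'n \<Rightarrow> real ^ 'n \<Rightarrow> real ^ 'n \<Rightarrow> real ^ 'N ^ 'N \<Rightarrow> real ^ ('N \<times> 'n) ^ ('N \<times> 'n)"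
  where "network_matrix A b c G =
    kronecker (mat 1) A + kronecker G ((columnvector b :: real ^ 1 ^ 'n) ** rowvector c)"

text \<open>The factors $I_N \otimes b$ and $I_N \otimes c^T$ have an index type \<open>'N \<times> 1\<close>, which is
  identified with \<open>'N\<close>.\<close>

definition network_input :: "real ^ 'n \<Rightarrow> real ^ 'N \<Rightarrow> real ^ ('N \<times> 'n)"
  where "network_input b u =
    kronecker (mat 1 :: real ^ 'N ^ 'N) (columnvector b :: real ^ 1 ^ 'n) *v (\<chi> p. u $ fst p)"

definition network_output :: "real ^ 'n \<Rightarrow> real ^ ('N \<times> 'n) \<Rightarrow> real ^ 'N"
  where "network_output c z =
    (\<chi> i. (kronecker (mat 1 :: real ^ 'N ^ 'N) (rowvector c :: real ^ 'n ^ 1) *v z) $ (i, 1))"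

definition transfer :: "real ^ 'n ^ 'n \<Rightarrow> real ^ 'n \<Rightarrow> real ^ 'n \<Rightarrow> complex \<Rightarrow> complex"
  where "transfer A b c s =
    (\<Sum>i\<in>UNIV. cvec c $ i * (matrix_inv (mat s - cmat A) *v cvec b) $ i)"

text \<open>The node matrix \<open>A\<close> itself need not be Hurwitz and may have an eigenvalue on the imaginary
  axis.  If the network matrix is Hurwitz, such an eigenvalue is controllable and observable, so it
  is a pole of the transfer function, where the rational function $h^{-1}$ takes the value $0$.\<close>

definition transfer_inv :: "real ^ 'n ^ 'n \<Rightarrow> real ^ 'n \<Rightarrow> real ^ 'n \<Rightarrow> complex \<Rightarrow> complex"
  where "transfer_inv A b c s =
    (if invertible (mat s - cmat A) then 1 / transfer A b c s else 0)"

section \<open>Second-order processes\<close>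

definition square_integrable :: "'a measure \<Rightarrow> ('a \<Rightarrow> 'b::euclidean_space) \<Rightarrow> bool"
  where "square_integrable M X \<longleftrightarrow>
    X \<in> borel_measurable M \<and> integrable M (\<lambda>\<xi>. (norm (X \<xi>))\<^sup>2)"

definition component :: "(real \<Rightarrow> 'a \<Rightarrow> real ^ 'k) \<Rightarrow> 'k \<Rightarrow> real \<Rightarrow> 'a \<Rightarrow> real"
  where "component X i t \<xi> = X t \<xi> $ i"

definition jointly_wss ::
  "'a measure \<Rightarrow> (real \<Rightarrow> 'a \<Rightarrow> real) \<Rightarrow> (real \<Rightarrow> 'a \<Rightarrow> real) \<Rightarrow> bool"
  where "jointly_wss M X Y \<longleftrightarrow>
    (\<forall>t. square_integrable M (X t) \<and> square_integrable M (Y t)) \<and>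
    (\<exists>m. \<forall>t. (LINT \<xi>|M. X t \<xi>) = m) \<and>
    (\<exists>m. \<forall>t. (LINT \<xi>|M. Y t \<xi>) = m) \<and>
    (\<forall>\<tau>. \<exists>r. \<forall>t. (LINT \<xi>|M. X t \<xi> * X (t - \<tau>) \<xi>) = r) \<and>
    (\<forall>\<tau>. \<exists>r. \<forall>t. (LINT \<xi>|M. Y t \<xi> * Y (t - \<tau>) \<xi>) = r) \<and>
    (\<forall>\<tau>. \<exists>r. \<forall>t. (LINT \<xi>|M. X t \<xi> * Y (t - \<tau>) \<xi>) = r)"

definition wss :: "'a measure \<Rightarrow> (real \<Rightarrow> 'a \<Rightarrow> real) \<Rightarrow> bool"
  where "wss M X \<longleftrightarrow> jointly_wss M X X"

definition uncorrelated ::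
  "'a measure \<Rightarrow> (real \<Rightarrow> 'a \<Rightarrow> real) \<Rightarrow> (real \<Rightarrow> 'a \<Rightarrow> real) \<Rightarrow> bool"
  where "uncorrelated M X Y \<longleftrightarrow>
    (\<forall>t s. (LINT \<xi>|M. X t \<xi> * Y s \<xi>) = (LINT \<xi>|M. X t \<xi>) * (LINT \<xi>|M. Y s \<xi>))"

text \<open>The common value for all \<open>t\<close>; meaningful for jointly wide-sense stationary processes.\<close>

definition cross_correlation ::
  "'a measure \<Rightarrow> (real \<Rightarrow> 'a \<Rightarrow> real) \<Rightarrow> (real \<Rightarrow> 'a \<Rightarrow> real) \<Rightarrow> real \<Rightarrow> real"
  where "cross_correlation M X Y \<tau> = (THE r. \<forall>t. (LINT \<xi>|M. X t \<xi> * Y (t - \<tau>) \<xi>) = r)"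

text \<open>The Fourier integral is a gauge integral over the real line.  It includes the Lebesgue
  integral of absolutely integrable correlations and also conditionally convergent improper
  integrals, for instance the sinc-shaped autocorrelation of ideal band-limited white noise.\<close>

definition has_cpsd ::
  "'a measure \<Rightarrow> (real \<Rightarrow> 'a \<Rightarrow> real) \<Rightarrow> (real \<Rightarrow> 'a \<Rightarrow> real) \<Rightarrow> real \<Rightarrow> complex \<Rightarrow> bool"
  where "has_cpsd M X Y \<omega> s \<longleftrightarrow>
    ((\<lambda>\<tau>. complex_of_real (cross_correlation M X Y \<tau>) * exp (- (\<i> * complex_of_real (\<omega> * \<tau>))))
       has_integral s) UNIV"

definition cpsd ::
  "'a measure \<Rightarrow> (real \<Rightarrow> 'a \<Rightarrow> real) \<Rightarrow> (real \<Rightarrow> 'a \<Rightarrow> real) \<Rightarrow> real \<Rightarrow> complex"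
  where "cpsd M X Y \<omega> = (THE s. has_cpsd M X Y \<omega> s)"

definition spectral_matrix ::
  "'a measure \<Rightarrow> (real \<Rightarrow> 'a \<Rightarrow> real ^ 'k) \<Rightarrow> real \<Rightarrow> complex ^ 'k ^ 'k"
  where "spectral_matrix M X \<omega> = (\<chi> i j. cpsd M (component X i) (component X j) \<omega>)"

text \<open>Differentiability in the mean-square sense.\<close>

definition has_ms_derivative ::
  "'a measure \<Rightarrow> (real \<Rightarrow> 'a \<Rightarrow> 'b::euclidean_space) \<Rightarrow> ('a \<Rightarrow> 'b) \<Rightarrow> real \<Rightarrow> bool"
  where "has_ms_derivative M X D t \<longleftrightarrow>
    (\<forall>s. square_integrable M (X s)) \<and> square_integrable M D \<and>
    ((\<lambda>h. LINT \<xi>|M. (norm ((X (t + h) \<xi> - X t \<xi>) /\<^sub>R h - D \<xi>))\<^sup>2) \<longlongrightarrow> 0) (at 0)"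

end

theory Submission
  imports Defs "HOL-Computational_Algebra.Fundamental_Theorem_Algebra"
begin

text \<open>Let \<open>H\<close> be the network matrix and \<open>v\<close> the input term of \<open>x' = H x + v\<close>.  The
  cross-correlations of input and state, and those of the state, are bounded solutions on the whole
  line of linear differential equations with matrix \<open>- H\<close> respectively \<open>H\<close>, driven by the input
  correlations respectively by the former.  A bounded solution of \<open>z' = K z + f\<close>, where \<open>K\<close> has no
  purely imaginary eigenvalue, has an improper integral as soon as \<open>f\<close> has one, even if \<open>f\<close> is only
  conditionally integrable.  Taking Fourier integrals therefore turns the differential equations
  into linear ones.  Projecting onto the outputs gives
  \<open>(h\<inverse> - G) S (cnj h\<inverse> - G) = S\<^sub>w\<close>, and by symmetry of \<open>G\<close>
  the matrix \<open>S\<inverse> S\<^sub>w\<close> equals \<open>(G - Re h\<inverse>)\<^sup>2 + Im\<^sup>2 h\<inverse>\<close>.\<close>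

section \<open>Complex matrices and vectors\<close>

text \<open>Boundedness takes the place of decay: it comes from the Cauchy-Schwarz inequality and
  the constant second moments of the stationary state, and it excludes nonzero homogeneous
  solutions. The sign in \<open>- H\<close> stems from the lag, which enters the second factor as
  -\<tau>; the eigenvalues of \<open>- H\<close> lie in the right half plane, so the convergence
  lemmas treat both signs of the real part. Each of the two differential equations contributes one
  resolvent, of H at s and at -s with s = j \<omega>; as cnj s = -s and H is real these are
  conjugate, whence h and its conjugate. Nodes act on each other only through b and c, so the node
  states can be eliminated and leave the scalar h. Working with the inverse of h keeps the
  eigenvalues of A on the imaginary axis inside the argument: there the inverse is 0 and the same
  equation holds. Positivity of Sw makes S invertible.\<close>

lemma mat_mult_vec: "mat a *v v = a *s v" for v :: "'a::semiring_1 ^ 'n"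
  by (simp add: vec_eq_iff matrix_vector_mult_def mat_def if_distrib[of "\<lambda>c. c * _"] cong: if_cong)

lemma minus_mat_vec: "- K *v v = - (K *v v)" for K :: "'a::ring_1 ^ 'n ^ 'm"
  by (simp add: vec_eq_iff matrix_vector_mult_def sum_negf)

lemma mat_mult_left: "(mat a ** P) $ i $ j = a * P $ i $ j" for P :: "'a::semiring_1 ^ 'n ^ 'm"
  by (simp add: matrix_matrix_mult_def mat_def if_distrib[of "\<lambda>c. c * _"] cong: if_cong)

lemma mat_mult_right: "(P ** mat a) $ i $ j = P $ i $ j * a" for P :: "'a::semiring_1 ^ 'n ^ 'm"
  by (simp add: matrix_matrix_mult_def mat_def if_distrib[of "\<lambda>c. _ * c"] cong: if_cong)

lemma matrix_inv_left:
  fixes P :: "'a::semiring_1 ^ 'n ^ 'm"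
  assumes "invertible P"
  shows "matrix_inv P ** P = mat 1"
  using someI_ex[OF assms[unfolded invertible_def]] unfolding matrix_inv_def by blast

lemma matrix_inv_eqI:
  fixes P Q :: "'a::field ^ 'n ^ 'n"
  assumes "P ** Q = mat 1"
  shows "invertible P" "matrix_inv P = Q"
proof -
  show "invertible P" using assms invertible_right_inverse by blast
  then show "matrix_inv P = Q"
    by (metis assms matrix_inv_left matrix_mul_assoc matrix_mul_lid matrix_mul_rid)
qed

text \<open>The transpose of a singular square matrix is singular, and a kernel vector of the
  transpose pairs to zero with the whole range. Serves for \<open>s - A\<close> when s is an
  eigenvalue of A.\<close>

lemma left_null_vector:
  fixes P :: "'a::field ^ 'n ^ 'n"
  assumes "\<not> invertible P"
  obtains l where "l \<noteq> 0" "\<And>v. (\<Sum>k\<in>UNIV. l $ k * (P *v v) $ k) = 0"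
proof -
  have "\<nexists>B. B ** transpose P = mat 1"
  proof
    assume "\<exists>B. B ** transpose P = mat 1"
    then obtain B where "B ** transpose P = mat 1" by blast
    then have "P ** transpose B = mat 1" by (metis matrix_transpose_mul transpose_mat transpose_transpose)
    then show False using assms invertible_right_inverse by blast
  qed
  then obtain l where l: "l \<noteq> 0" "transpose P *v l = 0"
    using matrix_left_invertible_ker by metis
  have "(\<Sum>k\<in>UNIV. l $ k * (P *v v) $ k) = 0" for v
  proof -
    have "(\<Sum>k\<in>UNIV. l $ k * (P *v v) $ k) = (\<Sum>j\<in>UNIV. (transpose P *v l) $ j * v $ j)"
      unfolding matrix_vector_mult_def transpose_def
      by (simp add: sum_distrib_left sum_distrib_right, subst sum.swap) (simp add: algebra_simps)
    also have "\<dots> = 0" by (simp only: l zero_index mult_zero_left sum.neutral_const)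
    finally show ?thesis .
  qed
  with l(1) show thesis by (rule that)
qed

lemma hurwitz_imp_invertible:
  assumes "hurwitz P" "0 \<le> Re s"
  shows "invertible (mat s - cmat P)"
proof -
  have "v = 0" if "(mat s - cmat P) *v v = 0" for v
  proof -
    have "cmat P *v v = s *s v"
      using that by (simp add: matrix_vector_mult_diff_rdistrib mat_mult_vec)
    then show "v = 0" using assms by (force simp: hurwitz_def)
  qed
  then show ?thesis using matrix_left_invertible_ker invertible_left_inverse by blast
qed

lemma cvec_nth [simp]: "cvec v $ i = of_real (v $ i)"
  by (simp add: cvec_def)

lemma cmat_nth [simp]: "cmat P $ i $ j = of_real (P $ i $ j)"
  by (simp add: cmat_def map_matrix_def)

lemma cnj_mat_vec:
  "cmat P *v (\<chi> i. cnj (v $ i)) = (\<chi> i. cnj ((cmat P *v v) $ i))"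
  by (simp add: vec_eq_iff matrix_vector_mult_def)

lemma bounded_linear_axis: "bounded_linear (\<lambda>a::complex. axis i a :: complex ^ 'k)"
  unfolding linear_conv_bounded_linear[symmetric]
  by (rule linearI) (auto simp: axis_def vec_eq_iff)

lemma sum_axis: "(\<Sum>i\<in>UNIV. axis i (v $ i)) = v" for v :: "'a::comm_monoid_add ^ 'k"
  by (simp add: vec_eq_iff axis_def)

text \<open>A vector is the finite sum of its \<open>axis\<close> parts, each a bounded linear image
  of one component, so componentwise integrals add up.\<close>

lemma has_integral_vecI:
  fixes f :: "real \<Rightarrow> complex ^ 'k"
  assumes "\<And>i. ((\<lambda>t. f t $ i) has_integral I $ i) S"
  shows "(f has_integral I) S"
proof -
  have "((\<lambda>t. \<Sum>i\<in>UNIV. axis i (f t $ i)) has_integral (\<Sum>i\<in>UNIV. axis i (I $ i))) S"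
    using has_integral_linear[OF assms bounded_linear_axis]
    by (intro has_integral_sum) (auto simp: o_def)
  then show ?thesis by (simp only: sum_axis)
qed

lemma has_vector_derivative_vecI:
  fixes f :: "real \<Rightarrow> complex ^ 'k"
  assumes "\<And>i. ((\<lambda>t. f t $ i) has_vector_derivative D $ i) (at t)"
  shows "(f has_vector_derivative D) (at t)"
proof -
  have "((\<lambda>t. \<Sum>i\<in>UNIV. axis i (f t $ i)) has_vector_derivative (\<Sum>i\<in>UNIV. axis i (D $ i))) (at t)"
    by (intro has_vector_derivative_sum bounded_linear.has_vector_derivative[OF bounded_linear_axis] assms)
  then show ?thesis by (simp only: sum_axis)
qed

section \<open>Bounded solutions of linear differential equations\<close>

text \<open>Integrating factor: \<open>exp (- a t) * z t\<close> has derivative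
  \<open>exp (- a t) * f t\<close>, of norm at most \<open>e * exp (- Re a * t)\<close> from T on.
  The bound is the integral of the latter over {s..t}, for either sign of Re a.\<close>

lemma exp_weighted_bound:
  fixes z f :: "real \<Rightarrow> complex"
  assumes der: "\<And>t. (z has_vector_derivative a * z t + f t) (at t)"
    and f: "\<And>t. T \<le> t \<Longrightarrow> norm (f t) \<le> e" and "T \<le> s" "s < t" and nz: "Re a \<noteq> 0"
  shows "norm (exp (- (a * of_real t)) * z t - exp (- (a * of_real s)) * z s)
           \<le> e / Re a * (exp (- Re a * s) - exp (- Re a * t))"
proof -
  let ?F = "\<lambda>t. exp (- (a * of_real t)) * z t" and ?g = "\<lambda>t. - e / Re a * exp (- Re a * t)"
  have F: "(?F has_vector_derivative exp (- (a * of_real u)) * f u) (at u)" for u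
  proof -
    have "((\<lambda>t. exp (- (a * of_real t))) has_vector_derivative
             - a * exp (- (a * of_real u))) (at u)"
      by (rule has_vector_derivative_eq_rhs, rule has_vector_derivative_real_field)
        (auto intro!: derivative_eq_intros)
    from has_vector_derivative_mult[OF this der]
    show ?thesis by (rule has_vector_derivative_eq_rhs) (simp add: algebra_simps)
  qed
  have g: "(?g has_vector_derivative e * exp (- Re a * u)) (at u)" for u
    unfolding has_real_derivative_iff_has_vector_derivative[symmetric]
    using nz by (auto intro!: derivative_eq_intros)
  have "norm (?F t - ?F s) \<le> ?g t - ?g s"
  proof (rule differentiable_bound_general[OF \<open>s < t\<close>])
    show "continuous_on {s..t} ?F" "continuous_on {s..t} ?g"
      using F g by (auto intro!: continuous_at_imp_continuous_on dest: has_vector_derivative_continuous)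
    show "norm (exp (- (a * of_real u)) * f u) \<le> e * exp (- Re a * u)" if "s < u" for u
      using f[of u] that \<open>T \<le> s\<close> by (simp add: norm_mult mult.commute)
  qed (use F g in auto)
  then show ?thesis by (simp add: algebra_simps)
qed

text \<open>For Re a > 0 homogeneous solutions grow, so a bounded z is controlled by the future of
  f: the weighted bound is read at fixed s with t tending to infinity. For Re a < 0 the value at T
  is forgotten exponentially.\<close>

lemma scalar_tendsto_zero:
  fixes z f :: "real \<Rightarrow> complex"
  assumes der: "\<And>t. (z has_vector_derivative a * z t + f t) (at t)"
    and bdd: "\<And>t. 0 \<le> t \<Longrightarrow> norm (z t) \<le> C"
    and f: "(f \<longlongrightarrow> 0) at_top" and nz: "Re a \<noteq> 0"
  shows "(z \<longlongrightarrow> 0) at_top"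
proof (rule tendstoI)
  fix d :: real assume "d > 0"
  \<comment> \<open>Forcing of size e contributes at most e / |Re a| = d / 3, which leaves room for
    the strict bound by d.\<close>
  define e where "e = \<bar>Re a\<bar> * d / 3"
  have "e > 0" using \<open>d > 0\<close> nz by (simp add: e_def)
  from tendstoD[OF f this] obtain T0 where "\<And>t. T0 \<le> t \<Longrightarrow> norm (f t) < e"
    by (auto simp: eventually_at_top_linorder)
  then obtain T where T: "T \<ge> 0" "\<And>t. T \<le> t \<Longrightarrow> norm (f t) \<le> e"
    by (metis less_imp_le max.bounded_iff order_refl linear)
  note bound = exp_weighted_bound[OF der T(2) _ _ nz]
  consider "Re a > 0" | "Re a < 0" using nz by linarith
  then show "\<forall>\<^sub>F t in at_top. dist (z t) 0 < d"
  proof cases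
    case 1
    have "norm (z s) \<le> d / 3" if "T \<le> s" for s
    proof -
      have "exp (- Re a * s) * norm (z s) \<le> e / Re a * exp (- Re a * s) + C * exp (- Re a * t)"
        if "s < t" for t
      proof -
        have "norm (exp (- (a * of_real s)) * z s) \<le>
            norm (exp (- (a * of_real t)) * z t - exp (- (a * of_real s)) * z s)
              + norm (exp (- (a * of_real t)) * z t)"
          by norm
        also have "\<dots> \<le> e / Re a * (exp (- Re a * s) - exp (- Re a * t)) + exp (- Re a * t) * C"
          using bdd[of t] \<open>s < t\<close> \<open>T \<le> s\<close> \<open>T \<ge> 0\<close>
          by (intro add_mono bound) (auto simp: norm_mult)
        also have "\<dots> \<le> e / Re a * exp (- Re a * s) + C * exp (- Re a * t)"
          using \<open>e > 0\<close> 1 by (simp add: algebra_simps)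
        finally show ?thesis by (simp add: norm_mult)
      qed
      then have ev: "\<forall>\<^sub>F t in at_top. exp (- Re a * s) * norm (z s)
          \<le> e / Re a * exp (- Re a * s) + C * exp (- Re a * t)"
        by (rule eventually_mono[OF eventually_gt_at_top[of s]])
      have "((\<lambda>t. exp (- Re a * t)) \<longlongrightarrow> 0) at_top"
        using 1 by (intro filterlim_compose[OF exp_at_bot] filterlim_tendsto_neg_mult_at_bot[OF tendsto_const])
          (auto simp: filterlim_ident)
      then have "((\<lambda>t. e / Re a * exp (- Re a * s) + C * exp (- Re a * t))
          \<longlongrightarrow> e / Re a * exp (- Re a * s) + C * 0) at_top"
        by (intro tendsto_intros)
      from tendsto_lowerbound[OF this ev]
      have "exp (- Re a * s) * norm (z s) \<le> exp (- Re a * s) * (e / Re a)"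
        by (simp add: mult.commute)
      then have "norm (z s) \<le> e / Re a" by (rule mult_left_le_imp_le) simp
      then show ?thesis using 1 by (simp add: e_def)
    qed
    then show ?thesis unfolding eventually_at_top_linorder using \<open>d > 0\<close>
      by (intro exI[of _ T]) fastforce
  next
    case 2
    define K where "K = norm (exp (- (a * of_real T)) * z T)"
    have le: "norm (z t) \<le> d / 3 + K * exp (Re a * t)" if "T < t" for t
    proof -
      have "norm (exp (- (a * of_real t)) * z t) \<le>
            norm (exp (- (a * of_real t)) * z t - exp (- (a * of_real T)) * z T) + K"
        unfolding K_def by norm
      also have "\<dots> \<le> e / Re a * (exp (- Re a * T) - exp (- Re a * t)) + K"
        using bound[OF _ order_refl that] by simp
      also have "\<dots> \<le> d / 3 * exp (- Re a * t) + K"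
        using \<open>d > 0\<close> 2 by (simp add: e_def field_simps)
      finally have le: "exp (- (Re a * t)) * norm (z t) \<le> d / 3 * exp (- (Re a * t)) + K"
        by (simp add: norm_mult)
      have E: "exp (Re a * t) * exp (- (Re a * t)) = 1" by (simp flip: exp_add)
      then have "norm (z t) = exp (Re a * t) * (exp (- (Re a * t)) * norm (z t))"
        by (simp add: mult.assoc[symmetric])
      also have "\<dots> \<le> exp (Re a * t) * (d / 3 * exp (- (Re a * t)) + K)"
        using le by (intro mult_left_mono) auto
      also have "\<dots> = d / 3 * (exp (Re a * t) * exp (- (Re a * t))) + K * exp (Re a * t)"
        by (simp add: algebra_simps)
      finally show ?thesis by (simp add: E)
    qed
    have "((\<lambda>t. d / 3 + K * exp (Re a * t)) \<longlongrightarrow> d / 3 + K * 0) at_top"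
      using 2 by (intro tendsto_intros filterlim_compose[OF exp_at_bot]
          filterlim_tendsto_neg_mult_at_bot[OF tendsto_const]) (auto simp: filterlim_ident)
    then have "\<forall>\<^sub>F t in at_top. d / 3 + K * exp (Re a * t) < d"
      by (rule order_tendstoD(2)) (use \<open>d > 0\<close> in simp)
    with eventually_gt_at_top[of T] show ?thesis
    proof eventually_elim
      case (elim t)
      with le[of t] show ?case by simp
    qed
  qed
qed

section \<open>Annihilating polynomials and convergence for vector equations\<close>

lemma euclidean_sequence_dependent:
  fixes a :: "nat \<Rightarrow> 'e::euclidean_space"
  obtains c :: "nat \<Rightarrow> real" and n where "\<exists>i\<le>n. c i \<noteq> 0" "(\<Sum>i\<le>n. c i *\<^sub>R a i) = 0"
proof (cases "inj_on a {..DIM('e)}")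
  case True
  then have "card (a ` {..DIM('e)}) > DIM('e)" by (simp add: card_image)
  then have "dependent (a ` {..DIM('e)})" using independent_bound by (meson not_le)
  then obtain u where "\<exists>v\<in>a ` {..DIM('e)}. u v \<noteq> 0" "(\<Sum>v\<in>a ` {..DIM('e)}. u v *\<^sub>R v) = 0"
    by (subst (asm) real_vector.dependent_finite) auto
  then show thesis using that[of "DIM('e)" "u \<circ> a"] by (auto simp: sum.reindex[OF True])
next
  case False
  \<comment> \<open>Dependence of a set does not see repetitions, so a repeated vector supplies its
    own relation: the difference of the two equal terms.\<close>
  then obtain i j where ij: "i \<noteq> j" "a i = a j" by (auto simp: inj_on_def)
  define c :: "nat \<Rightarrow> real" where "c k = (if k = i then 1 else if k = j then - 1 else 0)" for k
  have "(\<Sum>k\<le>max i j. c k *\<^sub>R a k) = (\<Sum>k\<in>{i, j}. c k *\<^sub>R a k)"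
    by (rule sum.mono_neutral_right) (auto simp: c_def)
  also have "\<dots> = 0" using ij by (simp add: c_def)
  finally have "(\<Sum>k\<le>max i j. c k *\<^sub>R a k) = 0" .
  moreover have "\<exists>k\<le>max i j. c k \<noteq> 0" by (rule exI[of _ i]) (simp add: c_def)
  ultimately show thesis by (rule that[rotated])
qed

text \<open>The vector p(K) v, evaluated by Horner's scheme so that induction along
  \<open>pCons\<close> computes it.\<close>

definition poly_mat_vec :: "complex poly \<Rightarrow> complex ^ 'm ^ 'm \<Rightarrow> complex ^ 'm \<Rightarrow> complex ^ 'm"
  where "poly_mat_vec p K v = fold_coeffs (\<lambda>c u. c *s v + K *v u) p 0"

lemma poly_mat_vec_0 [simp]: "poly_mat_vec 0 K v = 0"
  by (simp add: poly_mat_vec_def)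

lemma poly_mat_vec_pCons [simp]: "poly_mat_vec (pCons c p) K v = c *s v + K *v poly_mat_vec p K v"
  by (cases "p = 0 \<and> c = 0") (auto simp: poly_mat_vec_def)

lemma poly_mat_vec_add: "poly_mat_vec (p + q) K v = poly_mat_vec p K v + poly_mat_vec q K v"
  by (induction p q rule: poly_induct2)
    (simp_all add: matrix_vector_right_distrib vector_sadd_rdistrib algebra_simps)

lemma poly_mat_vec_smult: "poly_mat_vec (smult a p) K v = a *s poly_mat_vec p K v"
  by (induction p) (simp_all add: vector_ssub_ldistrib vector_smult_assoc vec.scale vec.scale_right_distrib)

lemma poly_mat_vec_sum: "poly_mat_vec (sum f I) K v = (\<Sum>i\<in>I. poly_mat_vec (f i) K v)"
  by (induction I rule: infinite_finite_induct) (simp_all add: poly_mat_vec_add)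

lemma poly_mat_vec_monom: "poly_mat_vec (monom a i) K v = a *s (((*v) K) ^^ i) v"
  by (induction i) (simp_all add: monom_0 monom_Suc vec.scale)

lemma poly_mat_vec_linear_factor:
  "poly_mat_vec ([:- r, 1:] * p) K v = K *v poly_mat_vec p K v - r *s poly_mat_vec p K v"
proof -
  have "[:- r, 1:] * p = pCons 0 p + smult (- r) p" by simp
  then show ?thesis by (simp only: poly_mat_vec_add poly_mat_vec_smult) (simp add: vector_ssub_ldistrib)
qed

text \<open>Allows q(K) to be applied to the differential equation: q(K) z solves it again, with
  forcing q(K) f.\<close>

lemma mat_vec_poly_commute: "K *v poly_mat_vec p K v = poly_mat_vec p K (K *v v)"
  by (induction p) (simp_all add: matrix_vector_right_distrib vec.scale)

lemma bounded_linear_poly_mat_vec: "bounded_linear (poly_mat_vec p K)"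
proof (induction p)
  case (pCons a p)
  have "(*s) a = (*v) (mat a :: complex ^ 'a ^ 'a)"
    by (simp add: fun_eq_iff mat_mult_vec)
  then have "bounded_linear (\<lambda>v::complex^'a. a *s v)"
    by simp
  then show ?case
    by (auto intro!: bounded_linear_add bounded_linear_compose[OF matrix_vector_mul_bounded_linear] pCons)
qed (auto simp: bounded_linear_zero)

text \<open>The powers of K lie in a finite-dimensional real space of matrices, so they satisfy a
  nontrivial linear relation; its real coefficients are those of p.\<close>

lemma annihilating_poly:
  fixes K :: "complex ^ 'm ^ 'm"
  obtains p where "p \<noteq> 0" "\<And>v. poly_mat_vec p K v = 0"
proof -
  obtain c :: "nat \<Rightarrow> real" and n where c: "\<exists>i\<le>n. c i \<noteq> 0"
    and s: "(\<Sum>i\<le>n. c i *\<^sub>R (((**) K) ^^ i) (mat 1)) = 0"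
    by (rule euclidean_sequence_dependent)
  define p where "p = (\<Sum>i\<le>n. monom (complex_of_real (c i)) i)"
  have "coeff p i = c i" if "i \<le> n" for i
    using that by (simp add: p_def coeff_sum)
  with c have "p \<noteq> 0" by auto
  have pow: "(((*v) K) ^^ i) v = (((**) K) ^^ i) (mat 1) *v v" for i v
    by (induction i) (simp_all add: matrix_vector_mul_assoc)
  have scal: "complex_of_real a *s (B *v v) = (a *\<^sub>R B) *v v" for a v and B :: "complex ^ 'm ^ 'm"
    by (simp add: vec_eq_iff matrix_vector_mult_def sum_distrib_left scaleR_conv_of_real[where 'a=complex] mult.assoc)
  have dist: "(\<Sum>i\<in>I. F i) *v v = (\<Sum>i\<in>I. F i *v v)"
    for F :: "nat \<Rightarrow> complex ^ 'm ^ 'm" and I v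
    by (induction I rule: infinite_finite_induct) (simp_all add: matrix_vector_mult_add_rdistrib)
  have "poly_mat_vec p K v = (\<Sum>i\<le>n. c i *\<^sub>R (((**) K) ^^ i) (mat 1)) *v v" for v
    by (simp add: p_def poly_mat_vec_sum poly_mat_vec_monom pow scal dist)
  with s \<open>p \<noteq> 0\<close> that show thesis by simp
qed

text \<open>Linear factors \<open>X - r\<close> are peeled off a polynomial annihilating \<open>K\<close>: if
  \<open>(K - r) u \<longlongrightarrow> 0\<close> for \<open>u = q(K) z\<close>, then \<open>u\<close> solves the scalar equation with coefficient
  \<open>r\<close> up to a vanishing term if \<open>Re r \<noteq> 0\<close>, and \<open>K - r\<close> is invertible otherwise.\<close>

lemma tendsto_zero_linear_ode:
  fixes z f :: "real \<Rightarrow> complex ^ 'm" and K :: "complex ^ 'm ^ 'm"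
  assumes der: "\<And>t. (z has_vector_derivative K *v z t + f t) (at t)"
    and bdd: "\<And>t. 0 \<le> t \<Longrightarrow> norm (z t) \<le> C"
    and f: "(f \<longlongrightarrow> 0) at_top"
    and K: "\<And>r v. v \<noteq> 0 \<Longrightarrow> K *v v = r *s v \<Longrightarrow> Re r \<noteq> 0"
  shows "(z \<longlongrightarrow> 0) at_top"
proof -
  have main: "(z \<longlongrightarrow> 0) at_top"
    if "p \<noteq> 0" "((\<lambda>t. poly_mat_vec p K (z t)) \<longlongrightarrow> 0) at_top" for p
    using that
  proof (induction "degree p" arbitrary: p)
    case 0
    then obtain c where c: "p = [:c:]" "c \<noteq> 0" by (metis degree_eq_zeroE pCons_0_0)
    have "((\<lambda>t. mat (inverse c) *v poly_mat_vec p K (z t)) \<longlongrightarrow> mat (inverse c) *v 0) at_top"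
      by (intro bounded_linear.tendsto[OF matrix_vector_mul_bounded_linear] 0)
    then show ?case using c by (simp add: mat_mult_vec vector_smult_assoc)
  next
    case (Suc n)
    then obtain r where "poly p r = 0"
      using fundamental_theorem_of_algebra[of p] by (auto simp: constant_degree)
    then obtain q where q: "p = [:- r, 1:] * q" by (auto simp: poly_eq_0_iff_dvd)
    with \<open>p \<noteq> 0\<close> have "q \<noteq> 0" by auto
    then have "degree p = degree [:- r, 1:] + degree q" unfolding q by (intro degree_mult_eq) auto
    with Suc.hyps(2) have "n = degree q" by simp
    define u where "u t = poly_mat_vec q K (z t)" for t
    define v where "v t = poly_mat_vec p K (z t)" for t
    have v: "v t = K *v u t - r *s u t" for t
      by (simp only: u_def v_def q poly_mat_vec_linear_factor)
    have v0: "(v \<longlongrightarrow> 0) at_top" using Suc.prems unfolding v_def by simp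
    note bl = bounded_linear_poly_mat_vec[of q K]
    have "(u \<longlongrightarrow> 0) at_top"
    proof (cases "Re r = 0")
      case True
      have "invertible (K - mat r)"
      proof -
        have "v = 0" if "(K - mat r) *v v = 0" for v
        proof -
          have "K *v v = r *s v"
            using that by (simp add: matrix_vector_mult_diff_rdistrib mat_mult_vec)
          with K True show "v = 0" by blast
        qed
        then show ?thesis
          using matrix_left_invertible_ker invertible_left_inverse by blast
      qed
      then obtain L where L: "L ** (K - mat r) = mat 1" by (auto simp: invertible_def)
      have "v t = (K - mat r) *v u t" for t
        by (simp add: v matrix_vector_mult_diff_rdistrib mat_mult_vec)
      then have "u t = L *v v t" for t
        by (simp add: matrix_vector_mul_assoc L)
      moreover have "((\<lambda>t. L *v v t) \<longlongrightarrow> L *v 0) at_top"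
        by (intro bounded_linear.tendsto[OF matrix_vector_mul_bounded_linear] v0)
      moreover have "u = (\<lambda>t. L *v v t)" using calculation(1) by (rule ext)
      ultimately show ?thesis by simp
    next
      case False
      \<comment> \<open>Since K u = r u + v and u' = K u + q(K) f, this g makes each component of u
        a solution of u' = r u + g.\<close>
      define g where "g t = v t + poly_mat_vec q K (f t)" for t
      have "((\<lambda>t. poly_mat_vec q K (f t)) \<longlongrightarrow> poly_mat_vec q K 0) at_top"
        by (intro bounded_linear.tendsto[OF bl] f)
      then have "(g \<longlongrightarrow> 0 + 0) at_top"
        unfolding g_def using v0 linear_0[OF bounded_linear.linear[OF bl]] by (intro tendsto_add) auto
      then have g: "((\<lambda>t. g t $ i) \<longlongrightarrow> 0 $ i) at_top" for i
        by (intro tendsto_vec_nth) auto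
      have u: "((\<lambda>t. u t $ i) has_vector_derivative r * u t $ i + g t $ i) (at t)" for t i
      proof -
        have "(u has_vector_derivative poly_mat_vec q K (K *v z t + f t)) (at t)"
          unfolding u_def by (intro bounded_linear.has_vector_derivative[OF bl] der)
        moreover have "poly_mat_vec q K (K *v z t + f t) = r *s u t + g t"
          by (simp add: g_def v u_def mat_vec_poly_commute linear_add[OF bounded_linear.linear[OF bl]])
        ultimately have "((\<lambda>t. u t $ i) has_vector_derivative (r *s u t + g t) $ i) (at t)"
          using bounded_linear.has_vector_derivative[OF bounded_linear_vec_nth] by metis
        then show ?thesis by simp
      qed
      have ub: "norm (u t $ i) \<le> onorm (poly_mat_vec q K) * C" if "0 \<le> t" for t i
      proof -
        have "norm (u t $ i) \<le> norm (u t)" by (rule Finite_Cartesian_Product.norm_nth_le)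
        also have "\<dots> \<le> onorm (poly_mat_vec q K) * norm (z t)" unfolding u_def by (rule onorm[OF bl])
        also have "\<dots> \<le> onorm (poly_mat_vec q K) * C"
          by (intro mult_left_mono bdd that onorm_pos_le bl)
        finally show ?thesis .
      qed
      have "((\<lambda>t. u t $ i) \<longlongrightarrow> 0) at_top" for i
        using scalar_tendsto_zero[OF u ub _ False] g by simp
      then show ?thesis by (intro vec_tendstoI) simp
    qed
    with Suc.hyps(1)[OF \<open>n = degree q\<close> \<open>q \<noteq> 0\<close>] show ?case unfolding u_def by simp
  qed
  obtain p where "p \<noteq> 0" "\<And>v. poly_mat_vec p K v = 0" by (rule annihilating_poly[of K]) blast
  then show ?thesis using main by simp
qed

section \<open>Improper integrals of solutions over the whole line\<close>

lemma has_integral_UNIV_iff_antiderivative: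
  fixes f F :: "real \<Rightarrow> 'b::banach"
  assumes F: "\<And>t. (F has_vector_derivative f t) (at t)"
  shows "(f has_integral I) UNIV \<longleftrightarrow>
    (\<forall>e>0. \<exists>B. \<forall>a b. a \<le> - B \<longrightarrow> B \<le> b \<longrightarrow> norm (F b - F a - I) < e)"
proof -
  have int: "(f has_integral F b - F a) {a..b}" if "a \<le> b" for a b
    using that F by (intro fundamental_theorem_of_calculus) (auto intro: has_vector_derivative_at_within)
  \<comment> \<open>The gauge integral over the line is tested on intervals containing a ball around
    0. Their two ends vary independently, so the criterion means convergence at each end and not
    just a principal value.\<close>
  have ball: "ball 0 B \<subseteq> {a..b} \<longleftrightarrow> a \<le> - B \<and> B \<le> b" if "B > 0" for a b B :: real
    using that by (simp add: ball_eq_greaterThanLessThan greaterThanLessThan_subseteq_atLeastAtMost_iff)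
  have "(f has_integral I) UNIV \<longleftrightarrow>
    (\<forall>e>0. \<exists>B>0. \<forall>a b. a \<le> - B \<longrightarrow> B \<le> b \<longrightarrow> norm (F b - F a - I) < e)"
  proof -
    have iv: "integral {a..b} f = F b - F a" if "a \<le> - B" "B \<le> b" "B > 0" for a b B
      using int[of a b] that by (intro integral_unique) auto
    have "f integrable_on {a..b}" for a b
      using int[of a b] by (cases "a \<le> b") (auto simp: integrable_on_def)
    moreover have "(\<forall>a b. ball 0 B \<subseteq> {a..b} \<longrightarrow> norm (integral {a..b} f - I) < e) \<longleftrightarrow>
        (\<forall>a b. a \<le> - B \<longrightarrow> B \<le> b \<longrightarrow> norm (F b - F a - I) < e)" if "B > 0" for B e
      using iv[OF _ _ that] by (auto simp: ball[OF that])
    then have "(\<forall>e>0. \<exists>B>0. \<forall>a b. ball 0 B \<subseteq> {a..b} \<longrightarrow> norm (integral {a..b} f - I) < e) \<longleftrightarrow>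
        (\<forall>e>0. \<exists>B>0. \<forall>a b. a \<le> - B \<longrightarrow> B \<le> b \<longrightarrow> norm (F b - F a - I) < e)"
      by (metis (no_types))
    ultimately show ?thesis unfolding has_integral_alt'[of f] by simp
  qed
  also have "\<dots> \<longleftrightarrow> (\<forall>e>0. \<exists>B. \<forall>a b. a \<le> - B \<longrightarrow> B \<le> b \<longrightarrow> norm (F b - F a - I) < e)"
  proof (intro iffI allI impI)
    fix e :: real assume h: "\<forall>e>0. \<exists>B. \<forall>a b. a \<le> - B \<longrightarrow> B \<le> b \<longrightarrow> norm (F b - F a - I) < e" "e > 0"
    then obtain B where "\<forall>a b. a \<le> - B \<longrightarrow> B \<le> b \<longrightarrow> norm (F b - F a - I) < e" by blast
    then show "\<exists>B>0. \<forall>a b. a \<le> - B \<longrightarrow> B \<le> b \<longrightarrow> norm (F b - F a - I) < e"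
      by (intro exI[of _ "max B 1"]) auto
  qed blast
  finally show ?thesis .
qed

lemma tendsto_at_top_CauchyI:
  fixes F :: "real \<Rightarrow> 'b::banach"
  assumes "\<And>e. e > 0 \<Longrightarrow> \<exists>B. \<forall>a b. B \<le> a \<longrightarrow> B \<le> b \<longrightarrow> norm (F b - F a) < e"
  obtains l where "(F \<longlongrightarrow> l) at_top"
proof -
  have "Cauchy (\<lambda>n. F (real n))"
  proof (rule metric_CauchyI)
    fix e :: real assume "e > 0"
    from assms[OF this] obtain B where B: "\<And>a b. B \<le> a \<Longrightarrow> B \<le> b \<Longrightarrow> norm (F b - F a) < e" by blast
    obtain N where "B \<le> real N" using real_arch_simple by blast
    then show "\<exists>N. \<forall>m\<ge>N. \<forall>n\<ge>N. dist (F (real m)) (F (real n)) < e"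
      by (intro exI[of _ N]) (auto simp: dist_norm intro!: B order_trans[of B "real N"])
  qed
  then obtain l where l: "(\<lambda>n. F (real n)) \<longlonglongrightarrow> l" using Cauchy_convergent convergent_def by blast
  have "(F \<longlongrightarrow> l) at_top"
  proof (rule tendstoI)
    fix e :: real assume "e > 0"
    from assms[of "e / 2"] \<open>e > 0\<close> obtain B
      where B: "\<And>a b. B \<le> a \<Longrightarrow> B \<le> b \<Longrightarrow> norm (F b - F a) < e / 2" by auto
    have "dist (F t) l < e" if "B \<le> t" for t
    proof -
      have "\<forall>\<^sub>F n in sequentially. norm (F t - F (real n)) \<le> e / 2"
        using filterlim_real_sequentially[unfolded filterlim_at_top, rule_format, of B]
        by eventually_elim (use B that in \<open>auto intro: less_imp_le\<close>)
      moreover have "(\<lambda>n. norm (F t - F (real n))) \<longlonglongrightarrow> norm (F t - l)"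
        by (intro tendsto_intros l)
      ultimately have "norm (F t - l) \<le> e / 2" by (intro tendsto_upperbound) auto
      with \<open>e > 0\<close> show ?thesis by (simp add: dist_norm)
    qed
    then show "\<forall>\<^sub>F t in at_top. dist (F t) l < e" by (auto simp: eventually_at_top_linorder)
  qed
  then show thesis by (rule that)
qed

text \<open>The equation q' = K q + F with F tending to l has the limiting equilibrium -L l, where L
  inverts K. Shifting by it gives u' = K u + (F - l) with vanishing forcing. Although q is an
  antiderivative, it is bounded on the half line, because q = L (z - F).\<close>

lemma tendsto_at_top_linear_ode:
  fixes q z F :: "real \<Rightarrow> complex ^ 'm" and K L :: "complex ^ 'm ^ 'm"
  assumes q: "\<And>t. (q has_vector_derivative z t) (at t)"
    and z: "\<And>t. z t = K *v q t + F t"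
    and bdd: "\<And>t. norm (z t) \<le> C"
    and F: "(F \<longlongrightarrow> l) at_top" and cF: "continuous_on UNIV F"
    and K: "\<And>r v. v \<noteq> 0 \<Longrightarrow> K *v v = r *s v \<Longrightarrow> Re r \<noteq> 0"
    and L: "L ** K = mat 1"
  shows "(q \<longlongrightarrow> - (L *v l)) at_top"
proof -
  have KL: "K ** L = mat 1" using L by (simp add: matrix_left_right_inverse)
  \<comment> \<open>Convergence bounds F only eventually; compactness covers the initial
    segment.\<close>
  obtain B where B: "\<And>t. 0 \<le> t \<Longrightarrow> norm (F t) \<le> B"
  proof -
    from tendstoD[OF F zero_less_one] obtain T where T: "\<And>t. T \<le> t \<Longrightarrow> dist (F t) l < 1"
      by (auto simp: eventually_at_top_linorder)
    have "compact (F ` {0..T})"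
      by (intro compact_continuous_image continuous_on_subset[OF cF]) auto
    then obtain D where D: "\<And>t. t \<in> {0..T} \<Longrightarrow> norm (F t) \<le> D"
      by (meson bounded_iff compact_imp_bounded imageI)
    have "norm (F t) \<le> max D (1 + norm l)" if "0 \<le> t" for t
    proof (cases "t \<le> T")
      case False
      then have "norm (F t - l) < 1" using T[of t] by (simp add: dist_norm)
      then have "norm (F t) \<le> 1 + norm l" by norm
      then show ?thesis by simp
    qed (use D that in \<open>force simp: le_max_iff_disj\<close>)
    then show thesis by (rule that)
  qed
  define u where "u t = q t + L *v l" for t
  have "(u \<longlongrightarrow> 0) at_top"
  proof (rule tendsto_zero_linear_ode[OF _ _ _ K])
    show "(u has_vector_derivative K *v u t + (F t - l)) (at t)" for t
    proof -
      have "(u has_vector_derivative z t + 0) (at t)"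
        unfolding u_def by (intro has_vector_derivative_add q has_vector_derivative_const)
      then show ?thesis
        by (simp add: z u_def matrix_vector_right_distrib matrix_vector_mul_assoc KL)
    qed
    show "((\<lambda>t. F t - l) \<longlongrightarrow> 0) at_top" using F by (simp add: LIM_zero)
    show "norm (u t) \<le> onorm ((*v) L) * (C + B + norm l)" if "0 \<le> t" for t
    proof -
      have "u t = L *v (z t - F t + l)"
        by (simp add: u_def z matrix_vector_right_distrib matrix_vector_mul_assoc L)
      then have "norm (u t) \<le> onorm ((*v) L) * norm (z t - F t + l)"
        by (simp add: onorm)
      also have "\<dots> \<le> onorm ((*v) L) * (C + B + norm l)"
        using bdd[of t] B[OF that] norm_triangle_ineq4[of "z t" "F t"] norm_triangle_ineq[of "z t - F t" l]
        by (intro mult_left_mono onorm_pos_le) auto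
      finally show ?thesis .
    qed
  qed
  then have "((\<lambda>t. u t - L *v l) \<longlongrightarrow> 0 - L *v l) at_top" by (intro tendsto_intros)
  then show ?thesis by (simp add: u_def)
qed

text \<open>No decay of \<open>z\<close> or \<open>f\<close> is assumed.  An antiderivative \<open>q\<close> of \<open>z\<close> satisfies
  \<open>q' = K q + F\<close> for an antiderivative \<open>F\<close> of \<open>f\<close>, and it is \<open>F\<close> that converges at both ends.\<close>

proposition has_integral_linear_ode:
  fixes z f :: "real \<Rightarrow> complex ^ 'm" and K :: "complex ^ 'm ^ 'm"
  assumes der: "\<And>t. (z has_vector_derivative K *v z t + f t) (at t)"
    and bdd: "\<And>t. norm (z t) \<le> C"
    and f: "(f has_integral I) UNIV"
    and K: "\<And>r v. v \<noteq> 0 \<Longrightarrow> K *v v = r *s v \<Longrightarrow> Re r \<noteq> 0"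
  obtains J where "(z has_integral J) UNIV" "K *v J = - I"
proof -
  have "v = 0" if "K *v v = 0" for v using K[of v 0] that by auto
  then obtain L where L: "L ** K = mat 1" using matrix_left_invertible_ker[of K] by blast
  then have KL: "K ** L = mat 1" by (simp add: matrix_left_right_inverse)
  have cz: "continuous_on UNIV z"
    using der by (intro continuous_at_imp_continuous_on) (auto dest: has_vector_derivative_continuous)
  then have "isCont z t" for t by (simp add: continuous_on_eq_continuous_at)
  then obtain q where q: "\<And>t. (q has_vector_derivative z t) (at t)"
    using einterval_antiderivative[of "-\<infinity>" \<infinity> z] by auto
  then have cq: "continuous_on UNIV q"
    by (intro continuous_at_imp_continuous_on) (auto dest: has_vector_derivative_continuous)
  define F where "F t = z t - K *v q t" for t
  have dF: "(F has_vector_derivative f t) (at t)" for t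
  proof -
    have "(F has_vector_derivative (K *v z t + f t) - K *v z t) (at t)"
      unfolding F_def
      by (intro has_vector_derivative_diff der q
          bounded_linear.has_vector_derivative[OF matrix_vector_mul_bounded_linear])
    then show ?thesis by simp
  qed
  have cF: "continuous_on UNIV F"
    using dF by (intro continuous_at_imp_continuous_on) (auto dest: has_vector_derivative_continuous)
  have FI: "\<exists>B. \<forall>a b. a \<le> - B \<longrightarrow> B \<le> b \<longrightarrow> norm (F b - F a - I) < e" if "e > 0" for e
    using f that unfolding has_integral_UNIV_iff_antiderivative[OF dF] by blast
  have tri: "norm (x - y) < e" if "norm x < e / 2" "norm y < e / 2" for x y :: "complex ^ 'm" and e
    using norm_triangle_ineq4[of x y] that by linarith
  \<comment> \<open>Two integrals with the same left end -B differ by \<open>F b - F a\<close>, so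
    closeness of both to I yields the Cauchy criterion at the right end; likewise at the left end
    with right end B.\<close>
  obtain l1 where l1: "(F \<longlongrightarrow> l1) at_top"
  proof (rule tendsto_at_top_CauchyI)
    fix e :: real assume "e > 0"
    then obtain B where B: "\<And>a b. a \<le> - B \<Longrightarrow> B \<le> b \<Longrightarrow> norm (F b - F a - I) < e / 2"
      using FI[of "e / 2"] by auto
    have "norm (F b - F a) < e" if "B \<le> a" "B \<le> b" for a b
      using tri[OF B[OF order_refl that(2)] B[OF order_refl that(1)]] by simp
    then show "\<exists>B. \<forall>a b. B \<le> a \<longrightarrow> B \<le> b \<longrightarrow> norm (F b - F a) < e" by blast
  qed
  obtain l2 where l2: "((\<lambda>t. F (- t)) \<longlongrightarrow> l2) at_top"
  proof (rule tendsto_at_top_CauchyI)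
    fix e :: real assume "e > 0"
    then obtain B where B: "\<And>a b. a \<le> - B \<Longrightarrow> B \<le> b \<Longrightarrow> norm (F b - F a - I) < e / 2"
      using FI[of "e / 2"] by auto
    have "norm (F (- b) - F (- a)) < e" if "B \<le> a" "B \<le> b" for a b
    proof -
      have "- a \<le> - B" "- b \<le> - B" using that by auto
      from tri[OF B[OF this(1) order_refl] B[OF this(2) order_refl]] show ?thesis by simp
    qed
    then show "\<exists>B. \<forall>a b. B \<le> a \<longrightarrow> B \<le> b \<longrightarrow> norm (F (- b) - F (- a)) < e" by blast
  qed
  have I: "l1 - l2 = I"
  proof -
    have "((\<lambda>t. F t - F (- t)) \<longlongrightarrow> l1 - l2) at_top" by (intro tendsto_intros l1 l2)
    moreover have "((\<lambda>t. F t - F (- t)) \<longlongrightarrow> I) at_top"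
    proof (rule tendstoI)
      fix e :: real assume "e > 0"
      with FI obtain B where "\<And>a b. a \<le> - B \<Longrightarrow> B \<le> b \<Longrightarrow> norm (F b - F a - I) < e" by blast
      then show "\<forall>\<^sub>F t in at_top. dist (F t - F (- t)) I < e"
        unfolding eventually_at_top_linorder by (intro exI[of _ B]) (auto simp: dist_norm)
    qed
    ultimately show ?thesis by (intro tendsto_unique) auto
  qed
  have q1: "(q \<longlongrightarrow> - (L *v l1)) at_top"
    by (rule tendsto_at_top_linear_ode[OF q _ bdd l1 cF K L]) (simp add: F_def)
  \<comment> \<open>Time reversal turns the left end into a limit at infinity. It replaces K by -K,
    which has no purely imaginary eigenvalue either, and F by -F(-t), with limit -l2.\<close>
  have q2: "((\<lambda>t. q (- t)) \<longlongrightarrow> - ((- L) *v (- l2))) at_top"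
  proof (rule tendsto_at_top_linear_ode[where K = "- K" and F = "\<lambda>t. - F (- t)" and C = C])
    show "((\<lambda>t. q (- t)) has_vector_derivative - z (- t)) (at t)" for t
      using vector_diff_chain_at[OF has_vector_derivative_minus[OF has_vector_derivative_id] q]
      by (simp add: o_def)
    show "- z (- t) = - K *v q (- t) + - F (- t)" for t
      by (simp add: F_def minus_mat_vec)
    show "norm (- z (- t)) \<le> C" for t using bdd by simp
    show "((\<lambda>t. - F (- t)) \<longlongrightarrow> - l2) at_top" by (intro tendsto_intros l2)
    show "continuous_on UNIV (\<lambda>t. - F (- t))"
      by (intro continuous_intros continuous_on_compose2[OF cF]) auto
    show "- L ** - K = mat 1" using L by (simp add: matrix_matrix_mult_def vec_eq_iff)
    show "Re r \<noteq> 0" if "v \<noteq> 0" "- K *v v = r *s v" for r v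
    proof -
      have "K *v v = (- r) *s v" using that(2) by (simp add: vec_eq_iff matrix_vector_mult_def sum_negf minus_equation_iff)
      from K[OF that(1) this] show ?thesis by simp
    qed
  qed
  have neg: "- L *v - l2 = L *v l2" by (simp add: vec_eq_iff matrix_vector_mult_def)
  have KLv: "K *v (L *v v) = v" for v by (simp add: matrix_vector_mul_assoc KL)
  have "(z has_integral (- (L *v l1) + L *v l2)) UNIV"
    unfolding has_integral_UNIV_iff_antiderivative[OF q]
  proof (intro allI impI)
    fix e :: real assume "e > 0"
    then have e2: "e / 2 > 0" by simp
    obtain B1 where B1: "\<And>t. B1 \<le> t \<Longrightarrow> norm (q t + L *v l1) < e / 2"
      using tendstoD[OF q1 e2] by (auto simp: dist_norm eventually_at_top_linorder)
    obtain B2 where B2: "\<And>t. B2 \<le> t \<Longrightarrow> norm (q (- t) + L *v l2) < e / 2"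
      using tendstoD[OF q2 e2] by (auto simp: neg dist_norm eventually_at_top_linorder)
    have "norm (q b - q a - (- (L *v l1) + L *v l2)) < e" if "a \<le> - max B1 B2" "max B1 B2 \<le> b" for a b
      using tri[OF B1[of b] B2[of "- a"]] that by (simp add: algebra_simps)
    then show "\<exists>B. \<forall>a b. a \<le> - B \<longrightarrow> B \<le> b \<longrightarrow> norm (q b - q a - (- (L *v l1) + L *v l2)) < e"
      by blast
  qed
  moreover have "K *v (- (L *v l1) + L *v l2) = - I"
    by (simp add: matrix_vector_mult_diff_distrib KLv flip: I)
  ultimately show thesis by (rule that)
qed

section \<open>Fourier integrals\<close>

text \<open>The integral of \<open>has_cpsd\<close> for an arbitrary real function. It is applied
  also to the input-state correlation, which is not known to be a
  \<open>cross_correlation\<close>.\<close>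

definition fourier_has_integral :: "real \<Rightarrow> (real \<Rightarrow> real) \<Rightarrow> complex \<Rightarrow> bool" where
  "fourier_has_integral \<omega> g s \<longleftrightarrow>
    ((\<lambda>\<tau>. complex_of_real (g \<tau>) * exp (- (\<i> * complex_of_real (\<omega> * \<tau>)))) has_integral s) UNIV"

lemma fourier_has_integral_cmult:
  "fourier_has_integral \<omega> f s \<Longrightarrow> fourier_has_integral \<omega> (\<lambda>\<tau>. a * f \<tau>) (of_real a * s)"
  unfolding fourier_has_integral_def by (drule has_integral_mult_right[of _ _ _ "of_real a"]) (simp add: mult.assoc)

lemma fourier_has_integral_sum:
  assumes "finite K" "\<And>k. k \<in> K \<Longrightarrow> fourier_has_integral \<omega> (f k) (s k)"
  shows "fourier_has_integral \<omega> (\<lambda>\<tau>. \<Sum>k\<in>K. f k \<tau>) (\<Sum>k\<in>K. s k)"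
  using has_integral_sum[OF assms(1), of "\<lambda>k \<tau>. complex_of_real (f k \<tau>) * exp (- (\<i> * complex_of_real (\<omega> * \<tau>)))" s UNIV]
    assms(2)
  by (simp add: fourier_has_integral_def sum_distrib_right)

lemma fourier_has_integral_zero: "fourier_has_integral \<omega> (\<lambda>\<tau>. 0) 0"
  by (simp add: fourier_has_integral_def)

text \<open>Multiplying by the Fourier kernel turns the matrix P into K = P - j \<omega>. This shift
  leaves the real parts of the eigenvalues alone, and K J = -I is the resolvent equation for
  P.\<close>

lemma fourier_linear_ode:
  fixes P :: "real ^ 'k ^ 'k" and g f :: "'k \<Rightarrow> real \<Rightarrow> real"
  assumes der: "\<And>q \<tau>. (g q has_real_derivative (\<Sum>r\<in>UNIV. P $ q $ r * g r \<tau>) + f q \<tau>) (at \<tau>)"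
    and bdd: "\<And>q \<tau>. \<bar>g q \<tau>\<bar> \<le> C q"
    and P: "\<And>r v. v \<noteq> 0 \<Longrightarrow> cmat P *v v = r *s v \<Longrightarrow> Re r \<noteq> 0"
    and f: "\<And>q. fourier_has_integral \<omega> (f q) (I $ q)"
  obtains J where "\<And>q. fourier_has_integral \<omega> (g q) (J $ q)"
    "(mat (\<i> * complex_of_real \<omega>) - cmat P) *v J = I"
proof -
  define e where "e \<tau> = exp (- (\<i> * complex_of_real (\<omega> * \<tau>)))" for \<tau>
  define z where "z \<tau> = (\<chi> q. complex_of_real (g q \<tau>) * e \<tau>)" for \<tau>
  define F where "F \<tau> = (\<chi> q. complex_of_real (f q \<tau>) * e \<tau>)" for \<tau>
  define K where "K = cmat P - mat (\<i> * complex_of_real \<omega>)"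
  have de: "(e has_vector_derivative - (\<i> * complex_of_real \<omega>) * e \<tau>) (at \<tau>)" for \<tau>
    unfolding e_def of_real_mult
    by (rule has_vector_derivative_eq_rhs, rule has_vector_derivative_real_field)
      (auto intro!: derivative_eq_intros)
  have norm_e: "norm (e \<tau>) = 1" for \<tau> by (simp add: e_def)
  have "(z has_vector_derivative K *v z \<tau> + F \<tau>) (at \<tau>)" for \<tau>
  proof -
    have "((\<lambda>\<tau>. z \<tau> $ q) has_vector_derivative (K *v z \<tau> + F \<tau>) $ q) (at \<tau>)" for q
    proof -
      have der': "((\<lambda>\<tau>. complex_of_real (g q \<tau>)) has_vector_derivative
          complex_of_real ((\<Sum>r\<in>UNIV. P $ q $ r * g r \<tau>) + f q \<tau>)) (at \<tau>)"
        using der[of q \<tau>] by (intro has_vector_derivative_of_real)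
          (simp add: has_real_derivative_iff_has_vector_derivative)
      have K: "(K *v z \<tau>) $ q = (\<Sum>r\<in>UNIV. of_real (P $ q $ r) * z \<tau> $ r)
          - \<i> * complex_of_real \<omega> * z \<tau> $ q"
        by (simp add: K_def matrix_vector_mult_diff_rdistrib mat_mult_vec)
          (simp add: matrix_vector_mult_def)
      have "complex_of_real (g q \<tau>) * (- (\<i> * complex_of_real \<omega>) * e \<tau>)
          + complex_of_real ((\<Sum>r\<in>UNIV. P $ q $ r * g r \<tau>) + f q \<tau>) * e \<tau>
          = (K *v z \<tau> + F \<tau>) $ q"
        unfolding vector_add_component K
        by (simp add: z_def F_def distrib_right sum_distrib_right mult.assoc mult.left_commute)
      with has_vector_derivative_mult[OF der' de] show ?thesis by (simp add: z_def)
    qed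
    then show ?thesis by (rule has_vector_derivative_vecI)
  qed
  moreover have "norm (z \<tau>) \<le> (\<Sum>q\<in>UNIV. C q)" for \<tau>
  proof -
    have "norm (z \<tau>) \<le> (\<Sum>q\<in>UNIV. norm (z \<tau> $ q))" by (simp add: norm_vec_def L2_set_le_sum)
    also have "\<dots> \<le> (\<Sum>q\<in>UNIV. C q)"
      using bdd by (intro sum_mono) (simp add: z_def norm_mult norm_e)
    finally show ?thesis by simp
  qed
  moreover have "(F has_integral I) UNIV"
    using f by (intro has_integral_vecI) (simp add: F_def e_def fourier_has_integral_def)
  moreover have "Re r \<noteq> 0" if "v \<noteq> 0" "K *v v = r *s v" for r v
  proof -
    have "cmat P *v v = (r + \<i> * complex_of_real \<omega>) *s v"
      using that(2) by (simp add: K_def matrix_vector_mult_diff_rdistrib mat_mult_vec vector_sadd_rdistrib diff_eq_eq)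
    from P[OF that(1) this] show ?thesis by simp
  qed
  ultimately obtain J where J: "(z has_integral J) UNIV" "K *v J = - I"
    by (rule has_integral_linear_ode)
  have "((\<lambda>t. z t $ q) has_integral J $ q) UNIV" for q
    using has_integral_linear[OF J(1) bounded_linear_vec_nth, of q] by (simp add: o_def)
  then have "fourier_has_integral \<omega> (g q) (J $ q)" for q
    by (simp add: z_def e_def fourier_has_integral_def)
  moreover have "(mat (\<i> * complex_of_real \<omega>) - cmat P) *v J = I"
    using J(2) by (simp add: K_def matrix_vector_mult_diff_rdistrib) (metis minus_diff_eq minus_minus)
  ultimately show thesis by (rule that)
qed

section \<open>Second-order processes\<close>

lemma square_integrable_add:
  assumes "square_integrable M X" "square_integrable M Y"
  shows "square_integrable M (\<lambda>\<xi>. X \<xi> + Y \<xi>)"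
proof -
  have "integrable M (\<lambda>\<xi>. (norm (X \<xi> + Y \<xi>))\<^sup>2)"
  proof (rule Bochner_Integration.integrable_bound)
    show "integrable M (\<lambda>\<xi>. 2 * (norm (X \<xi>))\<^sup>2 + 2 * (norm (Y \<xi>))\<^sup>2)"
      using assms by (auto simp: square_integrable_def)
    show "(\<lambda>\<xi>. (norm (X \<xi> + Y \<xi>))\<^sup>2) \<in> borel_measurable M"
      using assms by (auto simp: square_integrable_def)
    have "(norm (a + b))\<^sup>2 \<le> 2 * (norm a)\<^sup>2 + 2 * (norm b)\<^sup>2" for a b :: 'b
    proof -
      have "(norm (a + b))\<^sup>2 \<le> (norm a + norm b)\<^sup>2" by (intro power_mono norm_triangle_ineq) auto
      also have "\<dots> \<le> 2 * (norm a)\<^sup>2 + 2 * (norm b)\<^sup>2"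
        using sum_squares_bound[of "norm a" "norm b"] by (simp add: power2_sum)
      finally show ?thesis .
    qed
    then show "AE \<xi> in M. norm ((norm (X \<xi> + Y \<xi>))\<^sup>2) \<le> norm (2 * (norm (X \<xi>))\<^sup>2 + 2 * (norm (Y \<xi>))\<^sup>2)"
      by (auto intro!: AE_I2)
  qed
  then show ?thesis using assms by (auto simp: square_integrable_def)
qed

lemma square_integrable_scaleR:
  "square_integrable M X \<Longrightarrow> square_integrable M (\<lambda>\<xi>. a *\<^sub>R X \<xi>)"
  by (auto simp: square_integrable_def power_mult_distrib)

lemma square_integrable_diff:
  assumes "square_integrable M X" "square_integrable M Y"
  shows "square_integrable M (\<lambda>\<xi>. X \<xi> - Y \<xi>)"
  using square_integrable_add[OF assms(1) square_integrable_scaleR[OF assms(2), of "- 1"]] by simp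

lemma square_integrable_sum:
  assumes "finite I" "\<And>i. i \<in> I \<Longrightarrow> square_integrable M (X i)"
  shows "square_integrable M (\<lambda>\<xi>. \<Sum>i\<in>I. X i \<xi>)"
  using assms
proof (induction I rule: finite_induct)
  case (insert i I)
  then show ?case using square_integrable_add[of M "X i" "\<lambda>\<xi>. \<Sum>i\<in>I. X i \<xi>"] by simp
qed (simp add: square_integrable_def)

lemma square_integrable_vec_nth:
  fixes X :: "'a \<Rightarrow> real ^ 'k"
  assumes "square_integrable M X"
  shows "square_integrable M (\<lambda>\<xi>. X \<xi> $ i)"
proof -
  have m: "(\<lambda>\<xi>. X \<xi> $ i) \<in> borel_measurable M"
    using assms by (intro borel_measurable_continuous_on[of "\<lambda>v. v $ i"])
      (auto simp: square_integrable_def intro!: continuous_intros)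
  have "integrable M (\<lambda>\<xi>. (norm (X \<xi> $ i))\<^sup>2)"
  proof (rule Bochner_Integration.integrable_bound)
    show "integrable M (\<lambda>\<xi>. (norm (X \<xi>))\<^sup>2)" using assms by (simp add: square_integrable_def)
    show "(\<lambda>\<xi>. (norm (X \<xi> $ i))\<^sup>2) \<in> borel_measurable M" using m by auto
    show "AE \<xi> in M. norm ((norm (X \<xi> $ i))\<^sup>2) \<le> norm ((norm (X \<xi>))\<^sup>2)"
      using component_le_norm_cart[of _ i] by (auto intro!: AE_I2 simp: abs_le_square_iff[symmetric])
  qed
  with m show ?thesis by (simp add: square_integrable_def)
qed

lemma square_integrable_mult:
  fixes X Y :: "'a \<Rightarrow> real"
  assumes "square_integrable M X" "square_integrable M Y"
  shows "integrable M (\<lambda>\<xi>. X \<xi> * Y \<xi>)"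
proof (rule Bochner_Integration.integrable_bound)
  show "integrable M (\<lambda>\<xi>. (norm (X \<xi>))\<^sup>2 + (norm (Y \<xi>))\<^sup>2)"
    "(\<lambda>\<xi>. X \<xi> * Y \<xi>) \<in> borel_measurable M"
    using assms by (auto simp: square_integrable_def)
  have "\<bar>a * b\<bar> \<le> \<bar>a\<^sup>2 + b\<^sup>2\<bar>" for a b :: real
  proof -
    have "0 \<le> \<bar>a\<bar> * \<bar>b\<bar>" "2 * (\<bar>a\<bar> * \<bar>b\<bar>) \<le> a\<^sup>2 + b\<^sup>2"
      using sum_squares_bound[of "\<bar>a\<bar>" "\<bar>b\<bar>"] by auto
    then show ?thesis unfolding abs_mult by linarith
  qed
  then show "AE \<xi> in M. norm (X \<xi> * Y \<xi>) \<le> norm ((norm (X \<xi>))\<^sup>2 + (norm (Y \<xi>))\<^sup>2)"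
    by (auto intro!: AE_I2)
qed

lemma Cauchy_Schwarz_integral:
  fixes X Y :: "'a \<Rightarrow> real"
  assumes "square_integrable M X" "square_integrable M Y"
  shows "(LINT \<xi>|M. X \<xi> * Y \<xi>)\<^sup>2 \<le> (LINT \<xi>|M. (X \<xi>)\<^sup>2) * (LINT \<xi>|M. (Y \<xi>)\<^sup>2)"
proof -
  define a b p where "a = (LINT \<xi>|M. (X \<xi>)\<^sup>2)" and "b = (LINT \<xi>|M. (Y \<xi>)\<^sup>2)"
    and "p = (LINT \<xi>|M. X \<xi> * Y \<xi>)"
  have int: "integrable M (\<lambda>\<xi>. (X \<xi>)\<^sup>2)" "integrable M (\<lambda>\<xi>. (Y \<xi>)\<^sup>2)"
    using assms by (auto simp: square_integrable_def)
  note prod = square_integrable_mult[OF assms]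
  have key: "0 \<le> a - 2 * t * p + t\<^sup>2 * b" for t
  proof -
    have "0 \<le> (LINT \<xi>|M. (X \<xi> - t * Y \<xi>)\<^sup>2)" by simp
    also have "\<dots> = (LINT \<xi>|M. (X \<xi>)\<^sup>2 - 2 * t * (X \<xi> * Y \<xi>) + t\<^sup>2 * (Y \<xi>)\<^sup>2)"
      by (simp add: power2_diff power_mult_distrib algebra_simps)
    also have "\<dots> = a - 2 * t * p + t\<^sup>2 * b"
      using int prod by (simp add: a_def b_def p_def)
    finally show ?thesis .
  qed
  have "p\<^sup>2 \<le> a * b"
  proof (cases "b = 0")
    case True
    \<comment> \<open>For b = 0 and p nonzero this t makes the affine expression a - 2 t p equal to
      -1, contradicting \<open>key\<close>.\<close>
    then have "p = 0" using key[of "(a + 1) / (2 * p)"] by (cases "p = 0") auto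
    then show ?thesis using True by simp
  next
    case False
    have "0 \<le> b" by (simp add: b_def)
    \<comment> \<open>p / b is the minimiser of the quadratic in t.\<close>
    then show ?thesis using False key[of "p / b"] by (simp add: power2_eq_square field_simps)
  qed
  then show ?thesis by (simp add: a_def b_def p_def)
qed

lemma abs_integral_mult_le:
  fixes X Y :: "'a \<Rightarrow> real"
  assumes "square_integrable M X" "square_integrable M Y"
  shows "\<bar>LINT \<xi>|M. X \<xi> * Y \<xi>\<bar> \<le> sqrt ((LINT \<xi>|M. (X \<xi>)\<^sup>2) * (LINT \<xi>|M. (Y \<xi>)\<^sup>2))"
  using real_sqrt_le_mono[OF Cauchy_Schwarz_integral[OF assms]] by simp

text \<open>The error of the difference quotient is the expectation of X times the remainder E h. By
  Cauchy-Schwarz it is at most the L2 norm of X times that of E h, and mean-square differentiability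
  says that the latter vanishes.\<close>

lemma has_ms_derivative_correlation:
  fixes x :: "real \<Rightarrow> 'a \<Rightarrow> real ^ 'k" and X :: "'a \<Rightarrow> real"
  assumes x: "has_ms_derivative M x D t" and X: "square_integrable M X"
  shows "((\<lambda>s. LINT \<xi>|M. X \<xi> * x s \<xi> $ q) has_real_derivative (LINT \<xi>|M. X \<xi> * D \<xi> $ q)) (at t)"
proof -
  have sx: "square_integrable M (x s)" for s using x by (auto simp: has_ms_derivative_def)
  have sD: "square_integrable M D"
    and lim: "((\<lambda>h. LINT \<xi>|M. (norm ((x (t + h) \<xi> - x t \<xi>) /\<^sub>R h - D \<xi>))\<^sup>2) \<longlongrightarrow> 0) (at 0)"
    using x by (auto simp: has_ms_derivative_def)
  define E where "E h \<xi> = (x (t + h) \<xi> - x t \<xi>) /\<^sub>R h - D \<xi>" for h \<xi>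
  have sE: "square_integrable M (E h)" for h
    unfolding E_def by (intro square_integrable_diff square_integrable_scaleR sx sD)
  note ix = square_integrable_mult[OF X square_integrable_vec_nth[OF sx]]
  note iD = square_integrable_mult[OF X square_integrable_vec_nth[OF sD]]
  note iE = square_integrable_mult[OF X square_integrable_vec_nth[OF sE]]
  \<comment> \<open>Valid at h = 0 too: with division by zero both sides are minus the expectation
    of X times a component of D.\<close>
  have eq: "((LINT \<xi>|M. X \<xi> * x (t + h) \<xi> $ q) - (LINT \<xi>|M. X \<xi> * x t \<xi> $ q)) / h
      - (LINT \<xi>|M. X \<xi> * D \<xi> $ q) = (LINT \<xi>|M. X \<xi> * E h \<xi> $ q)" for h
  proof -
    have "X \<xi> * E h \<xi> $ q = inverse h * (X \<xi> * x (t + h) \<xi> $ q - X \<xi> * x t \<xi> $ q) - X \<xi> * D \<xi> $ q" for \<xi>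
      by (simp add: E_def algebra_simps)
    then have "(LINT \<xi>|M. X \<xi> * E h \<xi> $ q)
      = (LINT \<xi>|M. inverse h * (X \<xi> * x (t + h) \<xi> $ q - X \<xi> * x t \<xi> $ q) - X \<xi> * D \<xi> $ q)"
      by simp
    also have "\<dots> = inverse h * ((LINT \<xi>|M. X \<xi> * x (t + h) \<xi> $ q) - (LINT \<xi>|M. X \<xi> * x t \<xi> $ q))
      - (LINT \<xi>|M. X \<xi> * D \<xi> $ q)"
      using ix iD by simp
    finally show ?thesis by (simp add: divide_inverse mult.commute)
  qed
  have bound: "\<bar>LINT \<xi>|M. X \<xi> * E h \<xi> $ q\<bar> \<le> sqrt ((LINT \<xi>|M. (X \<xi>)\<^sup>2) * (LINT \<xi>|M. (norm (E h \<xi>))\<^sup>2))" for h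
  proof -
    have "(LINT \<xi>|M. (E h \<xi> $ q)\<^sup>2) \<le> (LINT \<xi>|M. (norm (E h \<xi>))\<^sup>2)"
    proof (rule integral_mono)
      show "integrable M (\<lambda>\<xi>. (E h \<xi> $ q)\<^sup>2)" "integrable M (\<lambda>\<xi>. (norm (E h \<xi>))\<^sup>2)"
        using square_integrable_vec_nth[OF sE] sE by (auto simp: square_integrable_def)
      show "(E h \<xi> $ q)\<^sup>2 \<le> (norm (E h \<xi>))\<^sup>2" for \<xi>
        using component_le_norm_cart[of "E h \<xi>" q] by (metis abs_ge_zero power2_abs power_mono)
    qed
    then have "sqrt ((LINT \<xi>|M. (X \<xi>)\<^sup>2) * (LINT \<xi>|M. (E h \<xi> $ q)\<^sup>2))
      \<le> sqrt ((LINT \<xi>|M. (X \<xi>)\<^sup>2) * (LINT \<xi>|M. (norm (E h \<xi>))\<^sup>2))"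
      by (intro real_sqrt_le_mono mult_left_mono) auto
    with abs_integral_mult_le[OF X square_integrable_vec_nth[OF sE]] show ?thesis
      by (rule order_trans)
  qed
  have "((\<lambda>h. sqrt ((LINT \<xi>|M. (X \<xi>)\<^sup>2) * (LINT \<xi>|M. (norm (E h \<xi>))\<^sup>2)))
     \<longlongrightarrow> sqrt ((LINT \<xi>|M. (X \<xi>)\<^sup>2) * 0)) (at 0)"
    using lim unfolding E_def by (intro tendsto_intros)
  then have "((\<lambda>h. sqrt ((LINT \<xi>|M. (X \<xi>)\<^sup>2) * (LINT \<xi>|M. (norm (E h \<xi>))\<^sup>2))) \<longlongrightarrow> 0) (at 0)"
    by simp
  then have "((\<lambda>h. LINT \<xi>|M. X \<xi> * E h \<xi> $ q) \<longlongrightarrow> 0) (at 0)"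
    by (rule Lim_null_comparison[rotated]) (use bound in simp)
  then show ?thesis unfolding DERIV_def eq[symmetric] by (rule LIM_zero_cancel)
qed

lemma jointly_wss_correlation:
  assumes "jointly_wss M X Y"
  shows "(LINT \<xi>|M. X t \<xi> * Y s \<xi>) = cross_correlation M X Y (t - s)"
proof -
  obtain r where r: "\<And>u. (LINT \<xi>|M. X u \<xi> * Y (u - (t - s)) \<xi>) = r"
    using assms unfolding jointly_wss_def by blast
  then have "cross_correlation M X Y (t - s) = r"
    unfolding cross_correlation_def by (intro the_equality) auto
  with r[of t] show ?thesis by simp
qed

lemma cross_correlation_eqI:
  assumes "\<And>t. (LINT \<xi>|M. X t \<xi> * Y (t - \<tau>) \<xi>) = r"
  shows "cross_correlation M X Y \<tau> = r"
  unfolding cross_correlation_def using assms by (intro the_equality) auto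

lemma has_cpsd_iff_fourier:
  "has_cpsd M X Y \<omega> s \<longleftrightarrow> fourier_has_integral \<omega> (cross_correlation M X Y) s"
  by (simp add: has_cpsd_def fourier_has_integral_def)

lemma cpsd_eqI: "has_cpsd M X Y \<omega> s \<Longrightarrow> cpsd M X Y \<omega> = s"
  unfolding cpsd_def has_cpsd_def by (rule the_equality) (auto intro: has_integral_unique)

text \<open>In matrix form, with s = j \<omega>: U (-s - H)^T = V and (s - H) X = U. The first
  equation comes from differentiating the state factor of the input-state correlation, the second
  from differentiating the first factor of the state correlation. U is the spectrum of the former,
  with the input held at time 0.\<close>

lemma linear_system_spectra:
  fixes H :: "real ^ 'p ^ 'p" and x v :: "real \<Rightarrow> 'a \<Rightarrow> real ^ 'p"
  assumes stable: "hurwitz H"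
    and state: "\<And>t. has_ms_derivative M x (\<lambda>\<xi>. H *v x t \<xi> + v t \<xi>) t"
    and steady: "\<And>p q. jointly_wss M (component x p) (component x q)"
    and v: "\<And>p t. square_integrable M (component v p t)"
    and V: "\<And>p q. fourier_has_integral \<omega> (\<lambda>\<tau>. LINT \<xi>|M. component v p 0 \<xi> * component v q (- \<tau>) \<xi>) (V $ p $ q)"
  obtains U X :: "complex ^ 'p ^ 'p" where
    "\<And>p. (mat (- (\<i> * complex_of_real \<omega>)) - cmat H) *v U $ p = V $ p"
    "\<And>q. (mat (\<i> * complex_of_real \<omega>) - cmat H) *v (\<chi> p. X $ p $ q) = (\<chi> p. U $ p $ q)"
    "\<And>p q. fourier_has_integral \<omega> (cross_correlation M (component x p) (component x q)) (X $ p $ q)"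
proof -
  define R where "R p q = cross_correlation M (component x p) (component x q)" for p q
  define W where "W p q \<tau> = (LINT \<xi>|M. component v p 0 \<xi> * component x q (- \<tau>) \<xi>)" for p q \<tau>
  note comp = component_def[abs_def]
  have x: "square_integrable M (component x p t)" for p t
    using steady[of p p] by (simp add: jointly_wss_def)
  have R: "(LINT \<xi>|M. component x p t \<xi> * component x q s \<xi>) = R p q (t - s)" for p q t s
    unfolding R_def by (rule jointly_wss_correlation[OF steady])
  have der: "((\<lambda>s. LINT \<xi>|M. X \<xi> * component x q s \<xi>) has_real_derivative
      (\<Sum>r\<in>UNIV. H $ q $ r * (LINT \<xi>|M. X \<xi> * component x r t \<xi>)) + (LINT \<xi>|M. X \<xi> * component v q t \<xi>)) (at t)"
    if X: "square_integrable M X" for X q t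
  proof -
    have "(LINT \<xi>|M. X \<xi> * (H *v x t \<xi> + v t \<xi>) $ q) =
      (LINT \<xi>|M. (\<Sum>r\<in>UNIV. H $ q $ r * (X \<xi> * component x r t \<xi>)) + X \<xi> * component v q t \<xi>)"
      by (simp add: comp matrix_vector_mult_def distrib_left sum_distrib_left mult.left_commute)
    also have "\<dots> = (\<Sum>r\<in>UNIV. H $ q $ r * (LINT \<xi>|M. X \<xi> * component x r t \<xi>)) + (LINT \<xi>|M. X \<xi> * component v q t \<xi>)"
      using square_integrable_mult[OF X x] square_integrable_mult[OF X v]
      by (subst Bochner_Integration.integral_add) (auto simp: Bochner_Integration.integral_sum)
    finally show ?thesis
      using has_ms_derivative_correlation[OF state[of t] X, where q = q] by (simp add: comp)
  qed
  \<comment> \<open>The derivative is taken at time \<open>0\<close> with the lag shifted to the second factor: the correlation of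
    input and state is not known to depend on the lag only.\<close>
  have dR: "(R p q has_real_derivative (\<Sum>r\<in>UNIV. H $ p $ r * R r q \<tau>) + W p q \<tau>) (at \<tau>)" for p q \<tau>
  proof -
    have "((\<lambda>t. R p q (t + \<tau>)) has_real_derivative (\<Sum>r\<in>UNIV. H $ p $ r * R r q \<tau>) + W p q \<tau>) (at 0)"
      using der[OF x[of q "- \<tau>"], of p 0] R[of _ _ q "- \<tau>"] by (simp add: W_def mult.commute)
    then show ?thesis using DERIV_shift[of "R p q" _ 0 \<tau>] by simp
  qed
  \<comment> \<open>The state is taken at time -\<tau>, so the chain rule reverses the signs of both
    the matrix and the forcing.\<close>
  have dW: "(W p q has_real_derivative
      (\<Sum>r\<in>UNIV. (- H) $ q $ r * W p r \<tau>) + - (LINT \<xi>|M. component v p 0 \<xi> * component v q (- \<tau>) \<xi>)) (at \<tau>)" for p q \<tau>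
    using der[OF v[of p 0], of q "- \<tau>"]
    unfolding DERIV_mirror W_def by (simp add: sum_negf)
  \<comment> \<open>Uniform in \<tau>: the input stays at time 0, and the second moment of the
    stationary state is the constant \<open>R q q 0\<close>.\<close>
  have bW: "\<bar>W p q \<tau>\<bar> \<le> sqrt ((LINT \<xi>|M. (component v p 0 \<xi>)\<^sup>2) * R q q 0)" for p q \<tau>
    using abs_integral_mult_le[OF v[of p 0] x[of q "- \<tau>"]]
    unfolding W_def power2_eq_square R by simp
  have bR: "\<bar>R p q \<tau>\<bar> \<le> sqrt (R p p 0 * R q q 0)" for p q \<tau>
    using abs_integral_mult_le[OF x[of p \<tau>] x[of q 0]]
    unfolding power2_eq_square R by simp
  have "\<exists>J. (\<forall>q. fourier_has_integral \<omega> (W p q) (J $ q)) \<and>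
      (mat (- (\<i> * complex_of_real \<omega>)) - cmat H) *v J = V $ p" for p
  proof -
    have cH: "cmat (- H) = - cmat H" by (simp add: vec_eq_iff)
    have "Re r \<noteq> 0" if "u \<noteq> 0" "cmat (- H) *v u = r *s u" for r u
    proof -
      have "cmat H *v u = (- r) *s u"
        using that(2) unfolding cH minus_mat_vec by (metis minus_minus vec.scale_minus_left)
      then have "Re (- r) < 0" using stable that(1) unfolding hurwitz_def by blast
      then show ?thesis by simp
    qed
    moreover have "fourier_has_integral \<omega> (\<lambda>\<tau>. - (LINT \<xi>|M. component v p 0 \<xi> * component v q (- \<tau>) \<xi>)) ((- V $ p) $ q)" for q
      using fourier_has_integral_cmult[OF V[of p q], of "- 1"] by simp
    ultimately obtain J where J: "\<And>q. fourier_has_integral \<omega> (W p q) (J $ q)"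
      "(mat (\<i> * complex_of_real \<omega>) - cmat (- H)) *v J = - V $ p"
      by (rule fourier_linear_ode[OF dW bW]) auto
    have "(mat (- (\<i> * complex_of_real \<omega>)) - cmat H) *v J = - ((mat (\<i> * complex_of_real \<omega>) - cmat (- H)) *v J)"
      by (simp add: cH matrix_vector_mult_diff_rdistrib matrix_vector_mult_add_rdistrib mat_mult_vec)
    with J show ?thesis by auto
  qed
  then obtain JW where JW: "\<And>p q. fourier_has_integral \<omega> (W p q) (JW p $ q)"
    "\<And>p. (mat (- (\<i> * complex_of_real \<omega>)) - cmat H) *v JW p = V $ p"
    by metis
  define U where "U = (\<chi> p. JW p)"
  have "\<exists>J. (\<forall>p. fourier_has_integral \<omega> (R p q) (J $ p)) \<and>
      (mat (\<i> * complex_of_real \<omega>) - cmat H) *v J = (\<chi> p. U $ p $ q)" for q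
  proof -
    have "Re r \<noteq> 0" if "u \<noteq> 0" "cmat H *v u = r *s u" for r u
      using stable that unfolding hurwitz_def by fastforce
    moreover have "fourier_has_integral \<omega> (W p q) ((\<chi> p. U $ p $ q) $ p)" for p
      using JW(1) by (simp add: U_def)
    ultimately obtain J where "\<And>p. fourier_has_integral \<omega> (R p q) (J $ p)"
      "(mat (\<i> * complex_of_real \<omega>) - cmat H) *v J = (\<chi> p. U $ p $ q)"
      by (rule fourier_linear_ode[OF dR bR]) auto
    then show ?thesis by blast
  qed
  then obtain JR where JR: "\<And>p q. fourier_has_integral \<omega> (R p q) (JR q $ p)"
    "\<And>q. (mat (\<i> * complex_of_real \<omega>) - cmat H) *v JR q = (\<chi> p. U $ p $ q)"
    by metis
  show thesis
  proof (rule that[of U "\<chi> p q. JR q $ p"])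
    show "(mat (- (\<i> * complex_of_real \<omega>)) - cmat H) *v U $ p = V $ p" for p
      using JW(2) by (simp add: U_def)
    have "(\<chi> p. JR q $ p) = JR q" for q by (simp add: vec_eq_iff)
    then show "(mat (\<i> * complex_of_real \<omega>) - cmat H) *v (\<chi> p. (\<chi> p q. JR q $ p) $ p $ q) = (\<chi> p. U $ p $ q)" for q
      using JR(2) by simp
    show "fourier_has_integral \<omega> (cross_correlation M (component x p) (component x q)) ((\<chi> p q. JR q $ p) $ p $ q)" for p q
      using JR(1) by (simp add: R_def)
  qed
qed

section \<open>The network\<close>

lemma network_matrix_nth:
  "network_matrix A b c G $ (i, k) $ (j, l) = (if i = j then A $ k $ l else 0) + G $ i $ j * (b $ k * c $ l)"
  by (simp add: network_matrix_def kronecker_def mat_def matrix_matrix_mult_def columnvector_def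
      rowvector_def sum_1)

lemma network_input_nth:
  fixes u :: "real ^ 'N"
  shows "network_input b u $ (i, k) = b $ k * u $ i"
proof -
  have "network_input b u $ (i, k) = (\<Sum>r\<in>(UNIV :: ('N \<times> 1) set). (if i = fst r then b $ k else 0) * u $ fst r)"
    by (simp add: network_input_def kronecker_def mat_def matrix_vector_mult_def columnvector_def
      if_distrib[of "\<lambda>x. x * _"] cong: if_cong)
  also have "\<dots> = (\<Sum>r\<in>{(i, 1 :: 1)}. (if i = fst r then b $ k else 0) * u $ fst r)"
    by (rule sum.mono_neutral_right) (auto simp: num1_eq1)
  also have "\<dots> = b $ k * u $ i" by simp
  finally show ?thesis .
qed

lemma network_output_nth: "network_output c z $ i = (\<Sum>k\<in>UNIV. c $ k * z $ (i, k))"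
proof -
  have "network_output c z $ i = (\<Sum>r\<in>UNIV. (if i = fst r then c $ snd r else 0) * z $ r)"
    by (simp add: network_output_def kronecker_def mat_def matrix_vector_mult_def rowvector_def
      if_distrib[of "\<lambda>x. x * _"] cong: if_cong)
  also have "\<dots> = (\<Sum>j\<in>UNIV. \<Sum>k\<in>UNIV. (if i = j then c $ k else 0) * z $ (j, k))"
    by (simp add: sum.cartesian_product split_def flip: UNIV_Times_UNIV)
  also have "\<dots> = (\<Sum>j\<in>UNIV. if i = j then \<Sum>k\<in>UNIV. c $ k * z $ (j, k) else 0)"
    by (intro sum.cong) auto
  finally show ?thesis by simp
qed

text \<open>The coupling blocks are multiples of the rank-one matrix b c^T: the network reaches node
  i only along b, through one scalar formed from the node outputs \<eta>. This is what permits
  eliminating the node states.\<close>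

lemma network_matrix_apply:
  fixes \<xi> :: "complex ^ ('N::finite \<times> 'n::finite)" and c :: "real ^ 'n"
  defines "\<eta> \<equiv> (\<chi> j. \<Sum>l\<in>UNIV. of_real (c $ l) * \<xi> $ (j, l))"
  shows "(cmat (network_matrix A b c G) *v \<xi>) $ (i, k) =
    (cmat A *v (\<chi> l. \<xi> $ (i, l))) $ k + of_real (b $ k) * (cmat G *v \<eta>) $ i"
proof -
  have "(cmat (network_matrix A b c G) *v \<xi>) $ (i, k) =
     (\<Sum>j\<in>UNIV. \<Sum>l\<in>UNIV. of_real (network_matrix A b c G $ (i, k) $ (j, l)) * \<xi> $ (j, l))"
    by (simp add: matrix_vector_mult_def sum.cartesian_product split_def flip: UNIV_Times_UNIV)
  also have "\<dots> = (\<Sum>j\<in>UNIV. (if i = j then \<Sum>l\<in>UNIV. of_real (A $ k $ l) * \<xi> $ (j, l) else 0)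
      + of_real (b $ k) * (of_real (G $ i $ j) * \<eta> $ j))"
    by (intro sum.cong)
      (auto simp: network_matrix_nth \<eta>_def sum_distrib_left sum.distrib[symmetric] algebra_simps)
  also have "\<dots> = (cmat A *v (\<chi> l. \<xi> $ (i, l))) $ k + of_real (b $ k) * (cmat G *v \<eta>) $ i"
    by (simp add: sum.distrib matrix_vector_mult_def sum_distrib_left)
  finally show ?thesis .
qed

text \<open>If \<open>s\<close> is an eigenvalue of \<open>A\<close>, a left null vector \<open>l\<close> of \<open>s - A\<close> is not orthogonal to
  \<open>b\<close>, as otherwise \<open>e\<^sub>i \<otimes> l\<close> would be a left null vector of \<open>s\<close> minus the network matrix.\<close>

lemma network_output_equation:
  fixes \<xi> :: "complex ^ ('N::finite \<times> 'n::finite)" and u :: "complex ^ 'N" and c :: "real ^ 'n"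
  defines "\<eta> \<equiv> (\<chi> j. \<Sum>l\<in>UNIV. of_real (c $ l) * \<xi> $ (j, l))"
  assumes stable: "hurwitz (network_matrix A b c G)" and s: "0 \<le> Re s"
    and h: "invertible (mat s - cmat A) \<Longrightarrow> transfer A b c s \<noteq> 0"
    and eq: "\<And>i k. s * \<xi> $ (i, k) - (cmat (network_matrix A b c G) *v \<xi>) $ (i, k) = of_real (b $ k) * u $ i"
  shows "(mat (transfer_inv A b c s) - cmat G) *v \<eta> = u"
proof -
  let ?P = "mat s - cmat A"
  \<comment> \<open>The total scalar input of node i, external plus coupling; the claim becomes that
    the inverse of h times the output equals g.\<close>
  define g where "g i = u $ i + (cmat G *v \<eta>) $ i" for i
  have block: "?P *v (\<chi> l. \<xi> $ (i, l)) = g i *s cvec b" for i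
  proof -
    have "(?P *v (\<chi> l. \<xi> $ (i, l))) $ k = (g i *s cvec b) $ k" for k
      using eq[of i k]
      by (simp add: network_matrix_apply g_def \<eta>_def matrix_vector_mult_diff_rdistrib mat_mult_vec
        algebra_simps)
    then show ?thesis unfolding vec_eq_iff by blast
  qed
  have "transfer_inv A b c s * \<eta> $ i = g i" for i
  proof (cases "invertible ?P")
    case True
    have "(\<chi> l. \<xi> $ (i, l)) = matrix_inv ?P *v (?P *v (\<chi> l. \<xi> $ (i, l)))"
      using matrix_inv_left[OF True] by (simp add: matrix_vector_mul_assoc)
    also have "\<dots> = g i *s (matrix_inv ?P *v cvec b)"
      by (simp add: block vec.scale)
    finally have "\<xi> $ (i, l) = g i * (matrix_inv ?P *v cvec b) $ l" for l
      by (simp add: vec_eq_iff)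
    then have "\<eta> $ i = g i * transfer A b c s"
      by (simp add: \<eta>_def transfer_def sum_distrib_left algebra_simps)
    then show ?thesis using h[OF True] True by (simp add: transfer_inv_def)
  next
    case False
    then obtain l where l: "l \<noteq> 0" "\<And>v. (\<Sum>k\<in>UNIV. l $ k * (?P *v v) $ k) = 0"
      by (rule left_null_vector) blast
    have "(\<Sum>k\<in>UNIV. l $ k * of_real (b $ k)) \<noteq> 0"
    proof
      assume lb: "(\<Sum>k\<in>UNIV. l $ k * of_real (b $ k)) = 0"
      let ?Q = "mat s - cmat (network_matrix A b c G)"
      from hurwitz_imp_invertible[OF stable s]
      obtain R where R: "?Q ** R = mat 1" by (auto simp: invertible_def)
      have null: "(\<Sum>k\<in>UNIV. l $ k * (?Q *v v) $ (i, k)) = 0" for v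
      proof -
        define d where "d = (cmat G *v (\<chi> j. \<Sum>l\<in>UNIV. of_real (c $ l) * v $ (j, l))) $ i"
        have "(?Q *v v) $ (i, k) = (?P *v (\<chi> l. v $ (i, l))) $ k - d * of_real (b $ k)" for k
          by (simp add: network_matrix_apply d_def matrix_vector_mult_diff_rdistrib mat_mult_vec)
        then have "(\<Sum>k\<in>UNIV. l $ k * (?Q *v v) $ (i, k))
          = (\<Sum>k\<in>UNIV. l $ k * (?P *v (\<chi> l. v $ (i, l))) $ k) - d * (\<Sum>k\<in>UNIV. l $ k * of_real (b $ k))"
          by (simp add: right_diff_distrib sum_subtractf sum_distrib_left mult.left_commute)
        then show ?thesis using l(2) lb by simp
      qed
      have "l $ k = 0" for k
      proof -
        have Qv: "?Q *v (R *v axis (i, k) 1) = axis (i, k) 1" by (simp add: matrix_vector_mul_assoc R)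
        show ?thesis using null[of "R *v axis (i, k) 1"]
          unfolding Qv by (simp add: axis_def if_distrib[of "\<lambda>x. _ * x"] cong: if_cong)
      qed
      with l(1) show False by (simp add: vec_eq_iff)
    qed
    \<comment> \<open>Pairing the block equation with l annihilates its left side, so g i = 0,
      matching the value 0 of \<open>transfer_inv\<close>.\<close>
    moreover have "g i * (\<Sum>k\<in>UNIV. l $ k * of_real (b $ k)) = 0"
      using l(2)[of "\<chi> l. \<xi> $ (i, l)"] unfolding block
      by (simp add: sum_distrib_left mult.left_commute)
    ultimately show ?thesis using False by (simp add: transfer_inv_def)
  qed
  then show ?thesis
    by (simp add: vec_eq_iff matrix_vector_mult_diff_rdistrib mat_mult_vec g_def)
qed

lemma network_output_wss:
  fixes x :: "real \<Rightarrow> 'a \<Rightarrow> real ^ ('N::finite \<times> 'n::finite)" and y :: "real \<Rightarrow> 'a \<Rightarrow> real ^ 'N"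
    and c :: "real ^ 'n"
  assumes steady: "\<And>p q. jointly_wss M (component x p) (component x q)"
    and y: "\<And>t \<xi>. \<xi> \<in> space M \<Longrightarrow> y t \<xi> = network_output c (x t \<xi>)"
    and sp: "finite_measure M"
  shows "jointly_wss M (component y i) (component y j)"
    and "cross_correlation M (component y i) (component y j) \<tau> = (\<Sum>k\<in>UNIV. \<Sum>l\<in>UNIV.
      c $ k * c $ l * cross_correlation M (component x (i, k)) (component x (j, l)) \<tau>)"
proof -
  have x: "square_integrable M (component x p t)" for p t
    using steady[of p p] by (simp add: jointly_wss_def)
  have ix: "integrable M (component x p t)" for p t
  proof -
    \<comment> \<open>On a finite measure space constants are square integrable, so the product
      bound with the constant 1 gives first moments.\<close>
    have "square_integrable M (\<lambda>_. 1 :: real)"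
      using finite_measure.integrable_const[OF sp] by (simp add: square_integrable_def)
    from square_integrable_mult[OF x[of p t] this] show ?thesis by simp
  qed
  note xx = square_integrable_mult[OF x x]
  have y_eq: "component y i t \<xi> = (\<Sum>k\<in>UNIV. c $ k *\<^sub>R component x (i, k) t \<xi>)" if "\<xi> \<in> space M" for i t \<xi>
    using y[OF that] by (simp add: component_def network_output_nth)
  have sy: "square_integrable M (component y i t)" for i t
  proof -
    have "square_integrable M (\<lambda>\<xi>. \<Sum>k\<in>UNIV. c $ k *\<^sub>R component x (i, k) t \<xi>)"
      by (intro square_integrable_sum square_integrable_scaleR x) simp
    then show ?thesis unfolding square_integrable_def
      by (simp add: y_eq cong: measurable_cong Bochner_Integration.integrable_cong)
  qed
  have corr: "(LINT \<xi>|M. component y i t \<xi> * component y j s \<xi>) = (\<Sum>k\<in>UNIV. \<Sum>l\<in>UNIV.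
      c $ k * c $ l * cross_correlation M (component x (i, k)) (component x (j, l)) (t - s))" for i j t s
  proof -
    have "(LINT \<xi>|M. component y i t \<xi> * component y j s \<xi>) = (LINT \<xi>|M. (\<Sum>k\<in>UNIV. \<Sum>l\<in>UNIV.
      c $ k * c $ l * (component x (i, k) t \<xi> * component x (j, l) s \<xi>)))"
      by (intro Bochner_Integration.integral_cong) (simp_all add: y_eq sum_product algebra_simps)
    also have "\<dots> = (\<Sum>k\<in>UNIV. \<Sum>l\<in>UNIV.
      c $ k * c $ l * (LINT \<xi>|M. component x (i, k) t \<xi> * component x (j, l) s \<xi>))"
      using xx by (simp add: Bochner_Integration.integral_sum)
    finally show ?thesis by (simp add: jointly_wss_correlation[OF steady])
  qed
  have mean: "\<exists>m. \<forall>t. (LINT \<xi>|M. component y i t \<xi>) = m" for i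
  proof -
    have "\<exists>m. \<forall>t. (LINT \<xi>|M. component x p t \<xi>) = m" for p
      using steady[of p p] by (simp add: jointly_wss_def)
    then obtain m where m: "\<And>p t. (LINT \<xi>|M. component x p t \<xi>) = m p" by metis
    have "(LINT \<xi>|M. component y i t \<xi>) = (LINT \<xi>|M. (\<Sum>k\<in>UNIV. c $ k * component x (i, k) t \<xi>))" for t
      by (intro Bochner_Integration.integral_cong) (simp_all add: y_eq)
    then have "(LINT \<xi>|M. component y i t \<xi>) = (\<Sum>k\<in>UNIV. c $ k * m (i, k))" for t
      using ix by (simp add: Bochner_Integration.integral_sum m)
    then show ?thesis by blast
  qed
  show "jointly_wss M (component y i) (component y j)"
    unfolding jointly_wss_def using sy mean by (simp add: corr)
  show "cross_correlation M (component y i) (component y j) \<tau> = (\<Sum>k\<in>UNIV. \<Sum>l\<in>UNIV.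
      c $ k * c $ l * cross_correlation M (component x (i, k)) (component x (j, l)) \<tau>)"
    by (rule cross_correlation_eqI) (simp add: corr)
qed

text \<open>Writing P = h - G and Q = cnj h - G, the assumptions say P Y Q = Sw, so the inverse of Y
  times Sw is Q P. With R = G - Re h the factors are j Im h - R and -j Im h - R; their scalar parts
  cancel in the cross term, leaving Q P = (Im h)^2 + R^2.\<close>

lemma spectral_matrix_factorization:
  fixes G :: "real ^ 'N ^ 'N" and Y Z :: "complex ^ 'N ^ 'N"
  assumes G: "transpose G = G" and Sw: "Sw \<noteq> 0"
    and Y: "(mat h - cmat G) ** Y = Z"
    and Z: "Z ** (mat (cnj h) - cmat G) = mat (complex_of_real Sw)"
  shows "invertible Y" "transpose (G - mat (Re h)) = G - mat (Re h)"
    "is_matrix_sqrt (cmat (G - mat (Re h)))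
      (matrix_inv Y ** mat (complex_of_real Sw) - mat (complex_of_real ((Im h)\<^sup>2)))"
proof -
  let ?P = "mat h - cmat G" and ?Q = "mat (cnj h) - cmat G" and ?s = "complex_of_real Sw"
  \<comment> \<open>One-sided inverses of square matrices are two-sided, so P can be moved behind Q;
    this exhibits Q P / Sw as the inverse of Y.\<close>
  have "?P ** (Y ** ?Q ** mat (1 / ?s)) = mat ?s ** mat (1 / ?s)"
    by (metis Y Z matrix_mul_assoc)
  also have "\<dots> = mat 1" using Sw by (simp add: vec_eq_iff mat_mult_left) (simp add: mat_def)
  finally have "(Y ** ?Q ** mat (1 / ?s)) ** ?P = mat 1" using matrix_left_right_inverse by blast
  then have inv: "Y ** (?Q ** mat (1 / ?s) ** ?P) = mat 1" by (simp add: matrix_mul_assoc)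
  from matrix_inv_eqI(1)[OF inv] show "invertible Y" .
  show "transpose (G - mat (Re h)) = G - mat (Re h)"
    using G by (simp add: vec_eq_iff transpose_def mat_def)
  have "(?Q ** mat (1 / ?s) ** ?P) ** mat ?s = ?Q ** ?P"
  proof -
    have c: "mat (1 / ?s) ** ?P ** mat ?s = ?P"
      using Sw by (simp add: vec_eq_iff mat_mult_left mat_mult_right)
    then show ?thesis by (metis matrix_mul_assoc)
  qed
  then have Yi: "matrix_inv Y ** mat ?s = ?Q ** ?P" by (simp add: matrix_inv_eqI(2)[OF inv])
  define R where "R = cmat (G - mat (Re h))"
  have P: "?P = mat (\<i> * of_real (Im h)) - R" and Q: "?Q = mat (- (\<i> * of_real (Im h))) - R"
    by (simp_all add: R_def vec_eq_iff mat_def complex_eq_iff)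
  have expand: "(mat a - R) ** (mat d - R) = mat (a * d) - mat (a + d) ** R + R ** R" for a d
  proof -
    have "((mat a - R) ** (mat d - R)) $ i $ j = (mat (a * d) - mat (a + d) ** R + R ** R) $ i $ j" for i j
    proof -
      have "((mat a - R) ** (mat d - R)) $ i $ j = (mat a ** mat d) $ i $ j - (mat a ** R) $ i $ j
          - (R ** mat d) $ i $ j + (R ** R) $ i $ j"
        by (simp add: matrix_matrix_mult_def algebra_simps sum_subtractf sum.distrib)
      then show ?thesis by (simp only: mat_mult_left mat_mult_right vector_minus_component
            vector_add_component) (simp add: mat_def algebra_simps)
    qed
    then show ?thesis unfolding vec_eq_iff by blast
  qed
  have "?Q ** ?P - mat (complex_of_real ((Im h)\<^sup>2)) = R ** R"
    unfolding P Q expand by (simp add: vec_eq_iff mat_mult_left) (simp add: mat_def power2_eq_square complex_eq_iff)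
  then show "is_matrix_sqrt (cmat (G - mat (Re h)))
      (matrix_inv Y ** mat (complex_of_real Sw) - mat (complex_of_real ((Im h)\<^sup>2)))"
    unfolding is_matrix_sqrt_def Yi R_def by simp
qed

theorem theorem10:
  fixes M :: "'a measure"
    and A :: "real ^ 'n ^ 'n" and b c :: "real ^ 'n" and G :: "real ^ 'N ^ 'N"
    and x :: "real \<Rightarrow> 'a \<Rightarrow> real ^ ('N \<times> 'n)" and w y :: "real \<Rightarrow> 'a \<Rightarrow> real ^ 'N"
    and Sw :: "real \<Rightarrow> real" and \<Omega> \<omega>\<^sub>0 :: real
  assumes "prob_space M"
    and G_nonneg: "\<And>i j. 0 \<le> G $ i $ j"
    and G_sym: "transpose G = G"
    and stable: "hurwitz (network_matrix A b c G)"
    and state: "\<And>t. has_ms_derivative M x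
                   (\<lambda>\<xi>. network_matrix A b c G *v x t \<xi> + network_input b (w t \<xi>)) t"
    and steady: "\<And>p q. jointly_wss M (component x p) (component x q)"
    and y_output: "\<And>t \<xi>. \<xi> \<in> space M \<Longrightarrow> y t \<xi> = network_output c (x t \<xi>)"
    and w_wss: "\<And>i. wss M (component w i)"
    and w_mean: "\<And>i t. (LINT \<xi>|M. component w i t \<xi>) = 0"
    and w_uncorrelated: "\<And>i j. i \<noteq> j \<Longrightarrow> uncorrelated M (component w i) (component w j)"
    and w_identical: "\<And>i j. cross_correlation M (component w i) (component w i) =
                             cross_correlation M (component w j) (component w j)"
    and "0 < \<Omega>"
    and Sw_psd: "\<And>i \<omega>. \<omega> \<in> {-\<Omega><..<\<Omega>} \<Longrightarrow>
                   has_cpsd M (component w i) (component w i) \<omega> (complex_of_real (Sw \<omega>))"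
    and Sw_pos: "\<And>\<omega>. \<omega> \<in> {-\<Omega><..<\<Omega>} \<Longrightarrow> 0 < Sw \<omega>"
    and "\<omega>\<^sub>0 \<in> {-\<Omega><..<\<Omega>}"
    and h_nonzero: "invertible (mat (\<i> * complex_of_real \<omega>\<^sub>0) - cmat A) \<Longrightarrow>
                      transfer A b c (\<i> * complex_of_real \<omega>\<^sub>0) \<noteq> 0"
  defines "hinv \<equiv> transfer_inv A b c (\<i> * complex_of_real \<omega>\<^sub>0)"
    and "S \<equiv> spectral_matrix M y \<omega>\<^sub>0"
  shows "(\<forall>i j. jointly_wss M (component y i) (component y j) \<and>
                has_cpsd M (component y i) (component y j) \<omega>\<^sub>0 (S $ i $ j)) \<and>
         invertible S \<and>
         (\<exists>R :: real ^ 'N ^ 'N. transpose R = R \<and>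
            is_matrix_sqrt (cmat R)
              (matrix_inv S ** mat (complex_of_real (Sw \<omega>\<^sub>0))
                 - mat (complex_of_real ((Im hinv)\<^sup>2))) \<and>
            G = mat (Re hinv) + R)"
proof -
  interpret prob_space M by fact
  define s where "s = \<i> * complex_of_real \<omega>\<^sub>0"
  define H where "H = network_matrix A b c G"
  define v where "v t \<xi> = network_input b (w t \<xi>)" for t \<xi>
  \<comment> \<open>V is Sw times the Kronecker product of the identity with b b^T: distinct inputs
    have zero correlation, as they are uncorrelated with mean zero.\<close>
  define V :: "complex ^ ('N \<times> 'n) ^ ('N \<times> 'n)" where
    "V = (\<chi> p q. of_real (b $ snd p * b $ snd q) * (if fst p = fst q then of_real (Sw \<omega>\<^sub>0) else 0))"
  have w: "square_integrable M (component w i t)" for i t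
    using w_wss[of i] by (simp add: wss_def jointly_wss_def)
  have v_w: "component v p t \<xi> = b $ snd p * component w (fst p) t \<xi>" for p t \<xi>
    by (cases p) (simp add: component_def v_def network_input_nth)
  have sv: "square_integrable M (component v p t)" for p t
    using square_integrable_scaleR[OF w, of "b $ snd p" "fst p" t] by (simp add: v_w[abs_def])
  have Vf: "fourier_has_integral \<omega>\<^sub>0 (\<lambda>\<tau>. LINT \<xi>|M. component v p 0 \<xi> * component v q (- \<tau>) \<xi>) (V $ p $ q)" for p q
  proof -
    have eq: "(LINT \<xi>|M. component v p 0 \<xi> * component v q (- \<tau>) \<xi>) =
        b $ snd p * b $ snd q * (LINT \<xi>|M. component w (fst p) 0 \<xi> * component w (fst q) (- \<tau>) \<xi>)" for \<tau>
      by (subst Bochner_Integration.integral_mult_right_zero[symmetric])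
        (simp add: v_w mult.assoc mult.left_commute)
    show ?thesis
    proof (cases "fst p = fst q")
      case True
      have "(LINT \<xi>|M. component w (fst p) 0 \<xi> * component w (fst p) (- \<tau>) \<xi>)
        = cross_correlation M (component w (fst p)) (component w (fst p)) \<tau>" for \<tau>
        using jointly_wss_correlation[OF w_wss[unfolded wss_def], of "fst p" 0 "- \<tau>"] by simp
      moreover have "fourier_has_integral \<omega>\<^sub>0 (cross_correlation M (component w (fst p)) (component w (fst p)))
          (of_real (Sw \<omega>\<^sub>0))"
        using Sw_psd[OF \<open>\<omega>\<^sub>0 \<in> _\<close>] by (simp add: has_cpsd_iff_fourier)
      ultimately show ?thesis
        using True fourier_has_integral_cmult[of \<omega>\<^sub>0 "cross_correlation M (component w (fst p)) (component w (fst p))" _ "b $ snd p * b $ snd q"]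
        by (simp add: eq V_def)
    next
      case False
      then have "(LINT \<xi>|M. component w (fst p) 0 \<xi> * component w (fst q) (- \<tau>) \<xi>) = 0" for \<tau>
        using w_uncorrelated[OF False] by (simp add: uncorrelated_def w_mean)
      then show ?thesis using False fourier_has_integral_zero by (simp add: eq V_def)
    qed
  qed
  obtain U X :: "complex ^ ('N \<times> 'n) ^ ('N \<times> 'n)" where
    U: "\<And>p. (mat (- s) - cmat H) *v U $ p = V $ p"
    and X: "\<And>q. (mat s - cmat H) *v (\<chi> p. X $ p $ q) = (\<chi> p. U $ p $ q)"
    and Xf: "\<And>p q. fourier_has_integral \<omega>\<^sub>0 (cross_correlation M (component x p) (component x q)) (X $ p $ q)"
    unfolding s_def H_def
    by (rule linear_system_spectra[OF stable state[folded v_def] steady sv Vf]) blast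

  define h where "h = transfer_inv A b c s"
  \<comment> \<open>\<beta> i is Sw times the Kronecker product of the i-th unit vector with b. Row
    (i, k) of V is b_k \<beta> i, so the rows of U belonging to node i are multiples of the single
    vector \<zeta> i.\<close>
  define \<beta> :: "'N \<Rightarrow> complex ^ ('N \<times> 'n)" where
    "\<beta> i = (\<chi> q. of_real (b $ snd q) * (if i = fst q then of_real (Sw \<omega>\<^sub>0) else 0))" for i
  have Re_s: "Re s = 0" by (simp add: s_def)
  have cs: "cnj s = - s" by (simp add: s_def)
  obtain L where L: "L ** (mat (- s) - cmat H) = mat 1"
    using hurwitz_imp_invertible[OF stable, of "- s"] Re_s by (auto simp: invertible_def H_def)
  then have L': "(mat (- s) - cmat H) ** L = mat 1" by (simp add: matrix_left_right_inverse)
  define \<zeta> where "\<zeta> i = L *v \<beta> i" for i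
  have \<zeta>: "(mat (- s) - cmat H) *v \<zeta> i = \<beta> i" for i
    by (simp add: \<zeta>_def matrix_vector_mul_assoc L')
  have U_\<zeta>: "U $ (i, k) = of_real (b $ k) *s \<zeta> i" for i k
  proof -
    have "V $ (i, k) = of_real (b $ k) *s \<beta> i" by (simp add: vec_eq_iff V_def \<beta>_def)
    then have "L *v ((mat (- s) - cmat H) *v U $ (i, k)) = of_real (b $ k) *s \<zeta> i"
      by (simp add: U \<zeta>_def vec.scale)
    then show ?thesis by (simp add: matrix_vector_mul_assoc L)
  qed
  \<comment> \<open>Z takes the outputs of the \<zeta> i, with the factor b_k of U split off; Y
    contracts both indices of X with c and will be S.\<close>
  define Z :: "complex ^ 'N ^ 'N" where "Z = (\<chi> i j. \<Sum>l\<in>UNIV. of_real (c $ l) * \<zeta> i $ (j, l))"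
  define Y :: "complex ^ 'N ^ 'N" where
    "Y = (\<chi> i j. \<Sum>k\<in>UNIV. \<Sum>l\<in>UNIV. of_real (c $ k * c $ l) * X $ (i, k) $ (j, l))"
  note out_eq = network_output_equation[OF stable, of s, folded H_def h_def]
  have MY: "(mat h - cmat G) ** Y = Z"
  proof -
    have "(mat h - cmat G) *v (\<chi> i. Y $ i $ j) = (\<chi> i. Z $ i $ j)" for j
    proof -
      \<comment> \<open>Contracting the second index with c first leaves a network state driven by
        column j of Z.\<close>
      define \<xi> where "\<xi> = (\<chi> p. \<Sum>l\<in>UNIV. of_real (c $ l) * X $ p $ (j, l))"
      have "s * \<xi> $ (i, k) - (cmat H *v \<xi>) $ (i, k) = of_real (b $ k) * (\<chi> i. Z $ i $ j) $ i" for i k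
      proof -
        have "(cmat H *v \<xi>) $ p = (\<Sum>l\<in>UNIV. of_real (c $ l) * (cmat H *v (\<chi> p. X $ p $ (j, l))) $ p)" for p
          unfolding matrix_vector_mult_def \<xi>_def
          by (simp add: sum_distrib_left, subst sum.swap) (simp add: algebra_simps)
        then have "s * \<xi> $ (i, k) - (cmat H *v \<xi>) $ (i, k) = (\<Sum>l\<in>UNIV. of_real (c $ l) *
            ((mat s - cmat H) *v (\<chi> p. X $ p $ (j, l))) $ (i, k))"
          by (simp add: \<xi>_def matrix_vector_mult_diff_rdistrib mat_mult_vec sum_distrib_left
              sum_subtractf algebra_simps)
        also have "\<dots> = of_real (b $ k) * Z $ i $ j"
          by (simp add: X U_\<zeta> Z_def sum_distrib_left mult.left_commute)
        finally show ?thesis by simp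
      qed
      from out_eq[OF _ _ this] Re_s h_nonzero
      have "(mat h - cmat G) *v (\<chi> i. \<Sum>k\<in>UNIV. of_real (c $ k) * \<xi> $ (i, k)) = (\<chi> i. Z $ i $ j)"
        by (simp add: s_def)
      moreover have "(\<chi> i. \<Sum>k\<in>UNIV. of_real (c $ k) * \<xi> $ (i, k)) = (\<chi> i. Y $ i $ j)"
        by (simp add: vec_eq_iff Y_def \<xi>_def sum_distrib_left mult.assoc)
      ultimately show ?thesis by simp
    qed
    then show ?thesis by (simp add: vec_eq_iff matrix_matrix_mult_def matrix_vector_mult_def)
  qed
  have ZM: "Z ** (mat (cnj h) - cmat G) = mat (complex_of_real (Sw \<omega>\<^sub>0))"
  proof -
    have "(mat h - cmat G) *v (\<chi> j. cnj (Z $ i $ j)) = axis i (of_real (Sw \<omega>\<^sub>0))" for i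
    proof -
      \<comment> \<open>As cnj s = -s and H is real, conjugation turns the equation at -s into one
        at s. The output equation is thus used at s only, and \<open>cnj h\<close> appears when
        conjugating back.\<close>
      define \<xi> where "\<xi> = (\<chi> q. cnj (\<zeta> i $ q))"
      have "s * \<xi> $ (j, k) - (cmat H *v \<xi>) $ (j, k) = of_real (b $ k) * axis i (of_real (Sw \<omega>\<^sub>0)) $ j" for j k
      proof -
        have "s * \<xi> $ (j, k) - (cmat H *v \<xi>) $ (j, k) = cnj (((mat (- s) - cmat H) *v \<zeta> i) $ (j, k))"
          by (simp add: \<xi>_def cnj_mat_vec matrix_vector_mult_diff_rdistrib mat_mult_vec cs)
        also have "\<dots> = of_real (b $ k) * axis i (of_real (Sw \<omega>\<^sub>0)) $ j"
          by (simp add: \<zeta> \<beta>_def axis_def)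
        finally show ?thesis .
      qed
      from out_eq[OF _ _ this] Re_s h_nonzero
      have "(mat h - cmat G) *v (\<chi> j. \<Sum>k\<in>UNIV. of_real (c $ k) * \<xi> $ (j, k)) = axis i (of_real (Sw \<omega>\<^sub>0))"
        by (simp add: s_def)
      moreover have "(\<chi> j. \<Sum>k\<in>UNIV. of_real (c $ k) * \<xi> $ (j, k)) = (\<chi> j. cnj (Z $ i $ j))"
        by (simp add: vec_eq_iff Z_def \<xi>_def)
      ultimately show ?thesis by simp
    qed
    then have eq: "(\<Sum>j\<in>UNIV. (mat h - cmat G) $ k $ j * cnj (Z $ i $ j)) = axis i (of_real (Sw \<omega>\<^sub>0)) $ k" for i k
      unfolding vec_eq_iff matrix_vector_mult_def by simp
    \<comment> \<open>The rows of Z satisfy equations with \<open>h - G\<close> acting from the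
      left; symmetry of G turns them into multiplication by \<open>cnj h - G\<close> from the
      right.\<close>
    have sym: "G $ j $ k = G $ k $ j" for j k using arg_cong[OF G_sym, of "\<lambda>P. P $ k $ j"] by (simp add: transpose_def)
    have "(Z ** (mat (cnj h) - cmat G)) $ i $ k = mat (complex_of_real (Sw \<omega>\<^sub>0)) $ i $ k" for i k
    proof -
      have "(Z ** (mat (cnj h) - cmat G)) $ i $ k
          = cnj (\<Sum>j\<in>UNIV. (mat h - cmat G) $ k $ j * cnj (Z $ i $ j))"
        unfolding matrix_matrix_mult_def
        by (simp, intro sum.cong) (auto simp: mat_def sym[of _ k] mult.commute)
      also have "\<dots> = mat (complex_of_real (Sw \<omega>\<^sub>0)) $ i $ k"
        unfolding eq by (simp add: axis_def mat_def)
      finally show ?thesis .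
    qed
    then show ?thesis unfolding vec_eq_iff by blast
  qed

  have fm: "finite_measure M" by unfold_locales
  have y_wss: "jointly_wss M (component y i) (component y j)" for i j
    by (rule network_output_wss(1)[OF steady _ fm]) (rule y_output)
  have y_corr: "cross_correlation M (component y i) (component y j) = (\<lambda>\<tau>. \<Sum>k\<in>UNIV. \<Sum>l\<in>UNIV.
      c $ k * c $ l * cross_correlation M (component x (i, k)) (component x (j, l)) \<tau>)" for i j
    by (rule ext, rule network_output_wss(2)[OF steady _ fm]) (rule y_output)
  have cp: "has_cpsd M (component y i) (component y j) \<omega>\<^sub>0 (Y $ i $ j)" for i j
  proof -
    have "fourier_has_integral \<omega>\<^sub>0 (\<lambda>\<tau>. \<Sum>k\<in>UNIV. \<Sum>l\<in>UNIV.
        c $ k * c $ l * cross_correlation M (component x (i, k)) (component x (j, l)) \<tau>)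
      (\<Sum>k\<in>UNIV. \<Sum>l\<in>UNIV. of_real (c $ k * c $ l) * X $ (i, k) $ (j, l))"
      by (intro fourier_has_integral_sum fourier_has_integral_cmult Xf finite)
    then show ?thesis unfolding has_cpsd_iff_fourier y_corr by (simp add: Y_def)
  qed
  have S: "S = Y"
    by (simp add: S_def spectral_matrix_def vec_eq_iff cpsd_eqI[OF cp])
  have Sw: "Sw \<omega>\<^sub>0 \<noteq> 0" using Sw_pos[OF \<open>\<omega>\<^sub>0 \<in> _\<close>] by simp
  have hinv: "hinv = h" by (simp add: hinv_def h_def s_def)
  note fact = spectral_matrix_factorization[OF G_sym Sw MY ZM]
  \<comment> \<open>The witness for the root is \<open>G - mat (Re h)\<close>, which is real and
    symmetric.\<close>
  have "G = mat (Re h) + (G - mat (Re h))" by simp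
  with fact cp y_wss show ?thesis unfolding S hinv by blast
qed

end
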